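(* Let $L>0$, let $\mathfrak a\in C^1([0,L];\mathbb R)$ and let $\mathfrak b:[0,L]\to\mathbb R$ be continuous. Put $\mathfrak f(x)=\int_0^x\mathfrak a(s)\,ds$ and $V=\mathfrak a^2/4$. Assume that there is $\mathbf x_0\in(0,L)$ such that $\mathbf x_0$ is the only point $x\in[0,L]$ with $V'(x)=0$, and $V(\mathbf x_0)=\min_{[0,L]}V$. Let $T>0$. Then for all $E\in V([0,L])$ and all $\delta>0$ there is $\varepsilon_0>0$ such that for all $0<\varepsilon<\varepsilon_0$, $$\mathcal C_0(T,\varepsilon)\ \ge\ \exp\Big(\frac1\varepsilon\Big(W_E(0)-\min_{[0,L]}W_E-E\,T-\delta\Big)\Big),\qquad W_E=\frac{\mathfrak f}{2}+d_{A,E}.$$ In particular, $$T_{\mathrm{unif}}(\{0\})\ \ge\ \sup_{E\in V([0,L])}\frac1E\Big[W_E(0)-\min_{[0,L]}W_E\Big],$$ where, in case $E=0$, one uses the conventions $c/0=+\infty$ for $c>0$ and $0/0=0$.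
   Context: Control problem. For $T,\varepsilon>0$, $y_0\in L^2(0,L)$ and $h\in L^2(0,T)$ consider $$(\partial_t+\mathfrak a\,\partial_x+\mathfrak b-\varepsilon\partial_x^2)y=0\ \text{ in }(0,T)\times(0,L),\quad y(t,0)=h(t),\ y(t,L)=0,\quad y(0,\cdot)=y_0 .$$ It has a unique solution $y\in C^0([0,T];L^2(0,L))$ in the sense of transposition, i.e. for all $\tau\in[0,T]$ and $u_0\in H^1_0(0,L)$, $(u(\tau),y_0)_{L^2}-(u_0,y(\tau))_{L^2}+\int_0^\tau\varepsilon\,\partial_xu(t,0)\,h(\tau-t)\,dt=0$, where $u$ solves $(\partial_t-\mathfrak a\partial_x-(\mathfrak a'-\mathfrak b)-\varepsilon\partial_x^2)u=0$, $u(t,0)=u(t,L)=0$, $u(0)=u_0$. Cost. For $y_0\in L^2(0,L)$ let $U(y_0)$ be the set of $h\in L^2(0,T)$ such that $y(T)=0$. Then $$\mathcal C_0(T,\varepsilon)=\sup_{\|y_0\|_{L^2(0,L)}\le1}\ \inf_{h\in U(y_0)}\|h\|_{L^2(0,T)}\in[0,+\infty].$$ Uniform control time. $T_{\mathrm{unif}}(\{0\})=\inf\{T>0:\ \exists K>0,\ \mathcal C_0(T,\varepsilon)\le K\ \text{for all }\varepsilon\in(0,1)\}$ (with $\inf\emptyset=+\infty$). Agmon distance. For $E\ge\min_{[0,L]}V$, $K_E=\{x\in[0,L]:V(x)\le E\}$ and $d_{A,E}(x)=\inf_{y\in K_E}\big|\int_y^x\sqrt{(V(s)-E)_+}\,ds\big|$,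 where $(r)_+=\max(r,0)$. *)

theory Defs
  imports "HOL-Analysis.Analysis"
begin

definition L2 :: "real set \<Rightarrow> (real \<Rightarrow> real) set" where
  "L2 S = {f. f \<in> borel_measurable (lebesgue_on S) \<and> integrable (lebesgue_on S) (\<lambda>x. (f x)\<^sup>2)}"

definition L2_inner :: "real set \<Rightarrow> (real \<Rightarrow> real) \<Rightarrow> (real \<Rightarrow> real) \<Rightarrow> real" where
  "L2_inner S f g = integral\<^sup>L (lebesgue_on S) (\<lambda>x. f x * g x)"

definition L2_norm :: "real set \<Rightarrow> (real \<Rightarrow> real) \<Rightarrow> real" where
  "L2_norm S f = sqrt (integral\<^sup>L (lebesgue_on S) (\<lambda>x. (f x)\<^sup>2))"

text \<open>Weak derivative on \<open>(0,L)\<close>, tested against compactly supported \<open>C\<^sup>1\<close> functions.\<close>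

definition weak_deriv :: "real \<Rightarrow> (real \<Rightarrow> real) \<Rightarrow> (real \<Rightarrow> real) \<Rightarrow> bool" where
  "weak_deriv L u v \<longleftrightarrow>
     (\<forall>\<phi> \<phi>'. (\<forall>x. (\<phi> has_real_derivative \<phi>' x) (at x)) \<and> continuous_on UNIV \<phi>' \<and>
        (\<exists>c d. 0 < c \<and> d < L \<and> (\<forall>x. x \<notin> {c..d} \<longrightarrow> \<phi> x = 0)) \<longrightarrow>
        L2_inner {0<..<L} u \<phi>' = - L2_inner {0<..<L} v \<phi>)"

text \<open>Elements of \<open>H\<^sup>1\<^sub>0(0,L)\<close> are given by their continuous representatives on \<open>[0,L]\<close>, so the
  boundary values are pointwise values.\<close>

definition H10 :: "real \<Rightarrow> (real \<Rightarrow> real) set" where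
  "H10 L = {u \<in> L2 {0<..<L}. (\<exists>v \<in> L2 {0<..<L}. weak_deriv L u v) \<and>
     continuous_on {0..L} u \<and> u 0 = 0 \<and> u L = 0}"

text \<open>\<open>u\<close> is the solution, with \<open>x\<close>-derivative \<open>ux\<close>, of
  \<open>(\<partial>\<^sub>t - a \<partial>\<^sub>x - (a' - b) - \<epsilon> \<partial>\<^sub>x\<^sup>2) u = 0\<close> on \<open>[0,T] \<times> [0,L]\<close> with
  Dirichlet boundary conditions and \<open>u(0) = u0\<close>; here \<open>a'\<close> is the derivative of \<open>a\<close>.
  The coefficients are continuous and independent of time, so for \<open>u0\<close> in \<open>H\<^sup>1\<^sub>0\<close> the
  (analytic) semigroup solution lies in \<open>C([0,T]; H\<^sup>1\<^sub>0)\<close>, hence is continuous on the closed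
  rectangle, and for \<open>t > 0\<close> it is \<open>C\<^sup>1\<close> in time and \<open>C\<^sup>2\<close> in space up to the boundary. It is
  therefore the unique solution in the classical sense used here. The values \<open>ux 0 x\<close> are irrelevant.\<close>

definition adjoint_solution ::
  "real \<Rightarrow> (real \<Rightarrow> real) \<Rightarrow> (real \<Rightarrow> real) \<Rightarrow> (real \<Rightarrow> real) \<Rightarrow> real \<Rightarrow> real \<Rightarrow> (real \<Rightarrow> real) \<Rightarrow>
   (real \<Rightarrow> real \<Rightarrow> real) \<Rightarrow> (real \<Rightarrow> real \<Rightarrow> real) \<Rightarrow> bool" where
  "adjoint_solution L a a' b T \<epsilon> u0 u ux \<longleftrightarrow>
     continuous_on ({0..T} \<times> {0..L}) (\<lambda>(t, x). u t x) \<and>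
     (\<forall>x\<in>{0..L}. u 0 x = u0 x) \<and>
     (\<forall>t\<in>{0..T}. u t 0 = 0 \<and> u t L = 0) \<and>
     (\<exists>ut uxx.
        continuous_on ({0<..T} \<times> {0..L}) (\<lambda>(t, x). ut t x) \<and>
        continuous_on ({0<..T} \<times> {0..L}) (\<lambda>(t, x). ux t x) \<and>
        continuous_on ({0<..T} \<times> {0..L}) (\<lambda>(t, x). uxx t x) \<and>
        (\<forall>t\<in>{0<..T}. \<forall>x\<in>{0..L}.
           ((\<lambda>s. u s x) has_real_derivative ut t x) (at t within {0..T}) \<and>
           (u t has_real_derivative ux t x) (at x within {0..L}) \<and>
           (ux t has_real_derivative uxx t x) (at x within {0..L}) \<and>
           ut t x - a x * ux t x - (a' x - b x) * u t x - \<epsilon> * uxx t x = 0))"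

text \<open>The solution by transposition of
  \<open>(\<partial>\<^sub>t + a \<partial>\<^sub>x + b - \<epsilon> \<partial>\<^sub>x\<^sup>2) y = 0\<close>, \<open>y(t,0) = h(t)\<close>, \<open>y(t,L) = 0\<close>, \<open>y(0) = y0\<close>.\<close>

definition transposition_solution ::
  "real \<Rightarrow> (real \<Rightarrow> real) \<Rightarrow> (real \<Rightarrow> real) \<Rightarrow> (real \<Rightarrow> real) \<Rightarrow> real \<Rightarrow> real \<Rightarrow> (real \<Rightarrow> real) \<Rightarrow>
   (real \<Rightarrow> real) \<Rightarrow> (real \<Rightarrow> real \<Rightarrow> real) \<Rightarrow> bool" where
  "transposition_solution L a a' b T \<epsilon> y0 h y \<longleftrightarrow>
     (\<forall>t\<in>{0..T}. y t \<in> L2 {0<..<L}) \<and>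
     (\<forall>t\<in>{0..T}. ((\<lambda>s. L2_norm {0<..<L} (\<lambda>x. y s x - y t x)) \<longlongrightarrow> 0) (at t within {0..T})) \<and>
     (\<forall>\<tau>\<in>{0..T}. \<forall>u0\<in>H10 L. \<forall>u ux. adjoint_solution L a a' b T \<epsilon> u0 u ux \<longrightarrow>
        L2_inner {0<..<L} (u \<tau>) y0 - L2_inner {0<..<L} u0 (y \<tau>)
          + integral\<^sup>L (lebesgue_on {0<..<\<tau>}) (\<lambda>t. \<epsilon> * ux t 0 * h (\<tau> - t)) = 0)"

definition null_controls ::
  "real \<Rightarrow> (real \<Rightarrow> real) \<Rightarrow> (real \<Rightarrow> real) \<Rightarrow> (real \<Rightarrow> real) \<Rightarrow> real \<Rightarrow> real \<Rightarrow> (real \<Rightarrow> real) \<Rightarrow>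
   (real \<Rightarrow> real) set" where
  "null_controls L a a' b T \<epsilon> y0 =
     {h \<in> L2 {0<..<T}. \<exists>y. transposition_solution L a a' b T \<epsilon> y0 h y \<and>
        (AE x in lebesgue_on {0<..<L}. y T x = 0)}"

text \<open>In \<^typ>\<open>ereal\<close> the infimum of the empty set is \<open>\<infinity>\<close>.\<close>

definition control_cost ::
  "real \<Rightarrow> (real \<Rightarrow> real) \<Rightarrow> (real \<Rightarrow> real) \<Rightarrow> (real \<Rightarrow> real) \<Rightarrow> real \<Rightarrow> real \<Rightarrow> ereal" where
  "control_cost L a a' b T \<epsilon> =
     (SUP y0 \<in> {y0 \<in> L2 {0<..<L}. L2_norm {0<..<L} y0 \<le> 1}.
        INF h \<in> null_controls L a a' b T \<epsilon> y0. ereal (L2_norm {0<..<T} h))"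

definition T_unif ::
  "real \<Rightarrow> (real \<Rightarrow> real) \<Rightarrow> (real \<Rightarrow> real) \<Rightarrow> (real \<Rightarrow> real) \<Rightarrow> ereal" where
  "T_unif L a a' b =
     Inf {ereal T | T. T > 0 \<and>
        (\<exists>K>0. \<forall>\<epsilon>\<in>{0<..<1}. control_cost L a a' b T \<epsilon> \<le> ereal K)}"

definition potential :: "(real \<Rightarrow> real) \<Rightarrow> real \<Rightarrow> real" where
  "potential a x = (a x)\<^sup>2 / 4"

definition agmon_dist :: "real \<Rightarrow> (real \<Rightarrow> real) \<Rightarrow> real \<Rightarrow> real \<Rightarrow> real" where
  "agmon_dist L V E x =
     (INF y \<in> {y \<in> {0..L}. V y \<le> E}. \<bar>LBINT s=y..x. sqrt (max (V s - E) 0)\<bar>)"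

definition W :: "real \<Rightarrow> (real \<Rightarrow> real) \<Rightarrow> real \<Rightarrow> real \<Rightarrow> real" where
  "W L a E x = (LBINT s=0..x. a s) / 2 + agmon_dist L (potential a) E x"

text \<open>\<open>W_E(0) - min W_E\<close>; the minimum over \<open>[0,L]\<close> is attained because \<open>W_E\<close> is continuous.\<close>

definition W_gap :: "real \<Rightarrow> (real \<Rightarrow> real) \<Rightarrow> real \<Rightarrow> real" where
  "W_gap L a E = W L a E 0 - (INF x \<in> {0..L}. W L a E x)"

text \<open>The quotient \<open>c / E\<close> for \<open>c \<ge> 0\<close>, with \<open>c / 0 = \<infinity>\<close> for \<open>c > 0\<close> and \<open>0 / 0 = 0\<close>.\<close>

definition conv_quotient :: "real \<Rightarrow> real \<Rightarrow> ereal" where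
  "conv_quotient c E = (if E = 0 then (if c > 0 then \<infinity> else 0) else ereal (c / E))"

end

theory Submission
  imports Defs
begin

text \<open>Separated solutions \<open>exp (- \<mu> * t / \<epsilon>) * \<phi> x\<close> of the adjoint equation bound the cost from below
  by \<open>exp (- \<mu> * T / \<epsilon>) * norm \<phi> / (\<epsilon> * \<bar>\<phi>' 0\<bar>)\<close> up to harmless factors. After the conjugation
  \<open>\<phi> = exp (- f / (2 * \<epsilon>)) * \<psi>\<close>, with \<open>f\<close> the primitive of \<open>a\<close>, the function \<open>\<psi>\<close> solves a
  semiclassical Schroedinger equation with potential \<open>V + O(\<epsilon>)\<close> and energy \<open>\<mu>\<close>. An oscillation
  argument produces such energies arbitrarily close to any \<open>E\<close> in the range of \<open>V\<close>. The energy
  \<open>(\<epsilon> * \<psi>')\<^sup>2 + k * \<psi>\<^sup>2\<close> grows from the Dirichlet point \<open>0\<close> to the well at least at the Agmon rate and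
  decays away from the well at most at that rate. Since the monotonicity of \<open>V\<close> on both sides of
  \<open>x0\<close> makes the Agmon distance equal to the integral of \<open>sqrt (max (V - E) 0)\<close> from \<open>x0\<close>, this bounds
  \<open>norm \<phi> / (\<epsilon> * \<bar>\<phi>' 0\<bar>)\<close> from below by \<open>exp ((W_gap - o(1)) / \<epsilon>)\<close>.\<close>

section \<open>Scalar ordinary differential equations\<close>

text \<open>The full potential \<open>V + \<epsilon> * (b - a' / 2)\<close> is only continuous,
  because \<open>a'\<close> and \<open>b\<close> are, so no differentiable energy weight can be
  built from it. The Agmon estimates therefore carry two functions: the true \<open>Q\<close>, and a
  differentiable \<open>t\<close>, later \<open>V - E\<close>, at distance at most
  \<open>2 * \<eta>\<close> from it. The parameter \<open>\<eta>\<close> is fixed before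
  \<open>\<epsilon>\<close> and absorbs at once the distance between \<open>\<mu>\<close> and
  \<open>E\<close>, the lower order terms and the smoothing of \<open>\<bar>t\<bar>\<close> near its
  zeros, at the price of multiples of \<open>sqrt \<eta>\<close> in the exponents. An eigenfunction
  may oscillate and vanish where \<open>W_E\<close> is minimal, so no pointwise lower bound on
  \<open>\<psi>\<close> itself can hold there. The energy, which contains
  \<open>p = \<epsilon> * \<psi>'\<close> as well, does not vanish; it is bounded pointwise, and a
  local integral inequality leads from it back to the norm of \<open>\<psi>\<close>. The
  normalization \<open>p 0 = 1\<close> makes the product of \<open>\<epsilon>\<close> and
  \<open>\<phi>' 0\<close> equal to \<open>1\<close>, so that only the norm of \<open>\<phi>\<close>
  remains to be estimated.\<close>

lemma continuous_on_interval_bound: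
  fixes g :: "real \<Rightarrow> real"
  assumes "continuous_on {a..b} g"
  obtains M where "\<And>x. x \<in> {a..b} \<Longrightarrow> \<bar>g x\<bar> \<le> M"
proof -
  have "bounded (g ` {a..b})"
    using assms by (intro compact_imp_bounded compact_continuous_image) auto
  then show thesis using that unfolding bounded_iff by (metis imageI real_norm_def)
qed

lemma has_real_derivative_nonneg_imp_le:
  fixes f :: "real \<Rightarrow> real"
  assumes "a \<le> b"
    and f: "\<And>x. x \<in> {a..b} \<Longrightarrow> (f has_real_derivative f' x) (at x within {a..b})"
    and "\<And>x. x \<in> {a..b} \<Longrightarrow> 0 \<le> f' x"
  shows "f a \<le> f b"
proof (rule DERIV_nonneg_imp_increasing_open[OF assms(1)])
  show "\<exists>y. (f has_real_derivative y) (at x) \<and> 0 \<le> y" if "a < x" "x < b" for x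
    using f[of x] assms(3)[of x] that at_within_Icc_at[of a x b] by auto
  show "continuous_on {a..b} f"
    using f by (rule DERIV_continuous_on)
qed

text \<open>The product \<open>n * exp (- G)\<close> is nondecreasing. The signs of \<open>n\<close>
  and \<open>g\<close> are free, so the lemma also serves for \<open>- n\<close> and
  \<open>- G\<close>, which turns a bound on \<open>\<bar>n'\<bar>\<close> into estimates in both
  directions.\<close>

lemma gronwall_exp:
  fixes n G :: "real \<Rightarrow> real"
  assumes "a \<le> b"
    and n: "\<And>x. x \<in> {a..b} \<Longrightarrow> (n has_real_derivative n' x) (at x within {a..b})"
    and G: "\<And>x. x \<in> {a..b} \<Longrightarrow> (G has_real_derivative g x) (at x within {a..b})"
    and le: "\<And>x. x \<in> {a..b} \<Longrightarrow> g x * n x \<le> n' x"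
  shows "n a * exp (G b - G a) \<le> n b"
proof -
  have "n a * exp (- G a) \<le> n b * exp (- G b)"
  proof (rule has_real_derivative_nonneg_imp_le[OF assms(1)])
    fix x assume x: "x \<in> {a..b}"
    show "((\<lambda>x. n x * exp (- G x)) has_real_derivative (n' x - g x * n x) * exp (- G x)) (at x within {a..b})"
      by (rule derivative_eq_intros n[OF x] G[OF x] refl)+ (simp add: algebra_simps)
    show "0 \<le> (n' x - g x * n x) * exp (- G x)"
      using le[OF x] by simp
  qed
  then have "n a * exp (- G a) * exp (G b) \<le> n b * exp (- G b) * exp (G b)"
    by (rule mult_right_mono) simp
  then show ?thesis
    by (simp add: mult.assoc flip: exp_add)
qed

text \<open>After the last point where \<open>u \<le> v\<close>, the Lipschitz condition lets
  \<open>u - v\<close> grow at most exponentially with rate \<open>K\<close>; since the difference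
  is nonpositive at that point, it cannot become positive.\<close>

lemma ode_comparison:
  fixes u v :: "real \<Rightarrow> real"
  assumes "a \<le> b"
    and u: "\<And>x. x \<in> {a..b} \<Longrightarrow> (u has_real_derivative u' x) (at x within {a..b})"
    and v: "\<And>x. x \<in> {a..b} \<Longrightarrow> (v has_real_derivative v' x) (at x within {a..b})"
    and u': "\<And>x. x \<in> {a..b} \<Longrightarrow> u' x \<le> F x (u x)"
    and v': "\<And>x. x \<in> {a..b} \<Longrightarrow> F x (v x) \<le> v' x"
    and lip: "\<And>x y z. x \<in> {a..b} \<Longrightarrow> \<bar>F x z - F x y\<bar> \<le> K * \<bar>z - y\<bar>"
    and "u a \<le> v a"
  shows "u b \<le> v b"
proof (rule ccontr)
  assume neg: "\<not> u b \<le> v b"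
  have cont: "continuous_on {a..b} u" "continuous_on {a..b} v"
    using u v by (blast intro: DERIV_continuous_on)+
  define S where "S = {x \<in> {a..b}. u x \<le> v x}"
  have "closed S"
    unfolding S_def by (rule continuous_on_closed_Collect_le cont closed_atLeastAtMost)+
  then have "compact S"
    by (simp add: compact_eq_bounded_closed S_def bounded_subset[OF bounded_closed_interval[of a b]] subset_eq)
  moreover have "S \<noteq> {}"
    using assms(1,7) by (auto simp: S_def)
  ultimately obtain c where c: "c \<in> S" "\<And>x. x \<in> S \<Longrightarrow> x \<le> c"
    using compact_attains_sup[of S] by auto
  then have cab: "c \<in> {a..b}" "u c \<le> v c" by (auto simp: S_def)
  have gt: "v x < u x" if "x \<in> {c<..b}" for x
    using c(2)[of x] that cab by (force simp: S_def)
  have "(u c - v c) * exp (- K * c) \<ge> (u b - v b) * exp (- K * b)"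
  proof (rule DERIV_nonpos_imp_decreasing_open[of c b "\<lambda>x. (u x - v x) * exp (- K * x)"])
    show "c \<le> b" using cab by simp
    show "continuous_on {c..b} (\<lambda>x. (u x - v x) * exp (- K * x))"
      using cab by (intro continuous_intros continuous_on_subset[OF cont(1)] continuous_on_subset[OF cont(2)]) auto
    fix x assume x: "c < x" "x < b"
    then have xab: "x \<in> {a..b}" and at: "at x within {a..b} = at x"
      using cab at_within_Icc_at[of a x b] by auto
    have "((\<lambda>x. (u x - v x) * exp (- K * x)) has_real_derivative
        (u' x - v' x - K * (u x - v x)) * exp (- K * x)) (at x)"
      by (rule derivative_eq_intros u[OF xab, unfolded at] v[OF xab, unfolded at] refl)+
        (simp add: algebra_simps)
    moreover have "u' x - v' x - K * (u x - v x) \<le> 0"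
      using u'[OF xab] v'[OF xab] lip[OF xab, of "u x" "v x"] gt[of x] x by auto
    ultimately show "\<exists>y. ((\<lambda>x. (u x - v x) * exp (- K * x)) has_real_derivative y) (at x) \<and> y \<le> 0"
      by (auto intro!: mult_nonpos_nonneg)
  qed
  moreover have "(u c - v c) * exp (- K * c) \<le> 0"
    using cab by (auto intro: mult_nonpos_nonneg)
  ultimately have "(u b - v b) * exp (- K * b) \<le> 0" by linarith
  then show False
    using neg by (simp add: mult_le_0_iff)
qed

text \<open>Picard's fixed point argument for the weighted unknown
  \<open>exp (- 2 * K * x) * u x\<close>. With this Bielecki weight the integral operator halves
  distances whatever the length \<open>L\<close>, so a single application of the contraction
  principle covers the whole interval.\<close>

lemma ode_exists:
  fixes F :: "real \<Rightarrow> real \<Rightarrow> real"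
  assumes L: "0 \<le> L" and K: "0 < K"
    and contF: "continuous_on ({0..L} \<times> UNIV) (\<lambda>(x, y). F x y)"
    and lip: "\<And>x y z. x \<in> {0..L} \<Longrightarrow> \<bar>F x z - F x y\<bar> \<le> K * \<bar>z - y\<bar>"
  obtains u where "u 0 = 0"
    "\<And>x. x \<in> {0..L} \<Longrightarrow> (u has_real_derivative F x (u x)) (at x within {0..L})"
proof -
  have contG: "continuous_on {0..L} (\<lambda>s. F s (exp (2 * K * s) * apply_bcontfun g s))" for g
    by (rule continuous_on_compose2[OF contF, of _ "\<lambda>s. (s, exp (2 * K * s) * apply_bcontfun g s)", simplified])
      (auto intro!: continuous_intros)
  define I where "I g x = integral {0..x} (\<lambda>s. F s (exp (2 * K * s) * apply_bcontfun g s))" for g x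
  define P where "P g x = exp (- 2 * K * x) * I g x" for g x
  have I_deriv: "(I g has_real_derivative F x (exp (2 * K * x) * apply_bcontfun g x)) (at x within {0..L})"
    if "x \<in> {0..L}" for g x
    unfolding I_def by (rule integral_has_real_derivative[OF contG that])
  have contI: "continuous_on {0..L} (I g)" for g
    using I_deriv by (rule DERIV_continuous_on)
  have contP: "continuous_on {0..L} (P g)" for g
    unfolding P_def by (intro continuous_intros contI)
  have cl: "clamp 0 L x \<in> {0..L}" for x
    using L clamp_in_interval[of 0 L x] by (simp add: cbox_interval)
  \<comment> \<open>The complete space used is that of bounded continuous functions on the whole
    line, so functions on \<open>{0..L}\<close> are extended constantly beyond the
    endpoints.\<close>
  have bc: "ext_cont (P g) 0 L \<in> bcontfun" for g
  proof -
    have "continuous_on UNIV (ext_cont (P g) 0 L)"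
      by (rule continuous_on_ext_cont) (simp add: contP cbox_interval)
    moreover have "bounded (range (ext_cont (P g) 0 L))"
    proof (rule bounded_subset)
      show "bounded (P g ` {0..L})"
        by (intro compact_imp_bounded compact_continuous_image contP) auto
      show "range (ext_cont (P g) 0 L) \<subseteq> P g ` {0..L}"
        using cl by (auto simp: ext_cont_def)
    qed
    ultimately show ?thesis by (simp add: bcontfun_def)
  qed
  define \<Phi> where "\<Phi> g = Bcontfun (ext_cont (P g) 0 L)" for g
  have app: "apply_bcontfun (\<Phi> g) x = P g (clamp 0 L x)" for g x
    unfolding \<Phi>_def Bcontfun_inverse[OF bc] by (simp add: ext_cont_def)
  have "dist (\<Phi> g) (\<Phi> h) \<le> 1/2 * dist g h" for g h
  proof (rule dist_bound)
    fix y
    define x where "x = clamp 0 L y"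
    have x: "x \<in> {0..L}" using cl by (simp add: x_def)
    define D where "D = dist g h"
    have D: "\<bar>apply_bcontfun g s - apply_bcontfun h s\<bar> \<le> D" for s
      using dist_bounded[of g s h] by (simp add: D_def dist_real_def)
    have sub: "{0..x} \<subseteq> {0..L}" using x by auto
    \<comment> \<open>The contraction factor \<open>1 / 2\<close> is the ratio of the Lipschitz
      constant \<open>K\<close> to the rate \<open>2 * K\<close> of the weight.\<close>
    have deriv: "((\<lambda>s. exp (2 * K * s) * (D/2)) has_real_derivative K * (exp (2 * K * s) * D)) (at s within {0..x})" for s
      by (auto intro!: derivative_eq_intros)
    have hi: "((\<lambda>s. K * (exp (2 * K * s) * D)) has_integral
        exp (2 * K * x) * (D/2) - exp (2 * K * 0) * (D/2)) {0..x}"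
      using x by (intro fundamental_theorem_of_calculus)
        (use deriv in \<open>auto simp flip: has_real_derivative_iff_has_vector_derivative\<close>)
    have int: "(\<lambda>s. F s (exp (2 * K * s) * apply_bcontfun g s)) integrable_on {0..x}" for g
      by (rule integrable_continuous_real continuous_on_subset[OF contG sub])+
    have "\<bar>I g x - I h x\<bar> \<le> exp (2 * K * x) * (D/2) - exp (2 * K * 0) * (D/2)"
      unfolding I_def integral_diff[OF int int, symmetric] real_norm_def[symmetric]
    proof (rule integral_norm_bound_integral[THEN order_trans[OF _ eq_refl]])
      show "(\<lambda>s. F s (exp (2 * K * s) * apply_bcontfun g s) - F s (exp (2 * K * s) * apply_bcontfun h s)) integrable_on {0..x}"
        by (intro integrable_diff int)
      show "(\<lambda>s. K * (exp (2 * K * s) * D)) integrable_on {0..x}" using hi by blast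
      fix s assume s: "s \<in> {0..x}"
      have "\<bar>F s (exp (2 * K * s) * apply_bcontfun g s) - F s (exp (2 * K * s) * apply_bcontfun h s)\<bar>
         \<le> K * \<bar>exp (2 * K * s) * apply_bcontfun g s - exp (2 * K * s) * apply_bcontfun h s\<bar>"
        using s sub by (intro lip) auto
      also have "\<dots> = K * (exp (2 * K * s) * \<bar>apply_bcontfun g s - apply_bcontfun h s\<bar>)"
        by (simp add: abs_mult flip: right_diff_distrib)
      also have "\<dots> \<le> K * (exp (2 * K * s) * D)"
        using D K by (intro mult_left_mono) auto
      finally show "norm (F s (exp (2 * K * s) * apply_bcontfun g s) - F s (exp (2 * K * s) * apply_bcontfun h s))
        \<le> K * (exp (2 * K * s) * D)" by simp
    next
      show "integral {0..x} (\<lambda>s. K * (exp (2 * K * s) * D)) =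
        exp (2 * K * x) * (D/2) - exp (2 * K * 0) * (D/2)"
        using hi by (rule integral_unique)
    qed
    also have "\<dots> \<le> exp (2 * K * x) * (D/2)"
      by (simp add: D_def)
    finally have "exp (- 2 * K * x) * \<bar>I g x - I h x\<bar> \<le> exp (- 2 * K * x) * (exp (2 * K * x) * (D/2))"
      by (rule mult_left_mono) simp
    also have "\<dots> = D/2"
      by (simp add: exp_minus)
    finally have "\<bar>P g x - P h x\<bar> \<le> D/2"
      by (simp add: P_def abs_mult flip: right_diff_distrib)
    then show "dist (apply_bcontfun (\<Phi> g) y) (apply_bcontfun (\<Phi> h) y) \<le> 1/2 * dist g h"
      by (simp add: app dist_real_def D_def flip: x_def)
  qed
  then obtain g where g: "\<Phi> g = g"
    using banach_fix_type[of "1/2" \<Phi>] by auto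
  have fixp: "exp (2 * K * x) * apply_bcontfun g x = I g x" if "x \<in> {0..L}" for x
  proof -
    have "clamp 0 L x = x"
      using that by (simp add: clamp_cancel_cbox cbox_interval)
    then have "apply_bcontfun g x = P g x"
      using app[of g x] by (simp add: g)
    then show ?thesis by (simp add: P_def exp_minus)
  qed
  show thesis
  proof
    show "I g 0 = 0" by (simp add: I_def)
    show "(I g has_real_derivative F x (I g x)) (at x within {0..L})" if "x \<in> {0..L}" for x
      using I_deriv[OF that, of g] by (simp add: fixp[OF that])
  qed
qed

section \<open>Dirichlet eigenvalues by the Pruefer angle\<close>

lemma sin_squared_lipschitz: "\<bar>(sin z)\<^sup>2 - (sin y)\<^sup>2\<bar> \<le> \<bar>z - y\<bar>" for y z :: real
proof -
  have "(sin z)\<^sup>2 - (sin y)\<^sup>2 = sin (z + y) * sin (z - y)"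
  proof -
    have "sin (z + y) * sin (z - y) = (sin z)\<^sup>2 * (cos y)\<^sup>2 - (cos z)\<^sup>2 * (sin y)\<^sup>2"
      by (simp add: sin_add sin_diff power2_eq_square algebra_simps)
    then show ?thesis by (simp add: cos_squared_eq algebra_simps)
  qed
  also have "\<bar>\<dots>\<bar> \<le> 1 * \<bar>z - y\<bar>"
    unfolding abs_mult by (intro mult_mono abs_sin_x_le_abs_x) auto
  finally show ?thesis by simp
qed

text \<open>In polar coordinates \<open>\<psi> = r * sin \<theta>\<close>,
  \<open>p = r * cos \<theta>\<close> the system for \<open>\<psi>\<close> and \<open>p\<close>
  decouples: the equation of the angle is free of \<open>r\<close>, and once the angle is known
  \<open>r' / r\<close> is the known function \<open>g\<close>. Hence a scalar existence theorem
  suffices for the second order equation.\<close>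

lemma pruefer_amplitude:
  fixes Q \<theta> :: "real \<Rightarrow> real"
  assumes eps: "0 < \<epsilon>"
    and Q: "continuous_on {0..L} Q"
    and \<theta>: "\<And>x. x \<in> {0..L} \<Longrightarrow>
      (\<theta> has_real_derivative (1 - (1 + Q x) * (sin (\<theta> x))\<^sup>2) / \<epsilon>) (at x within {0..L})"
  obtains r where "r 0 = 1"
    "\<And>x. x \<in> {0..L} \<Longrightarrow>
      ((\<lambda>x. r x * sin (\<theta> x)) has_real_derivative r x * cos (\<theta> x) / \<epsilon>) (at x within {0..L})"
    "\<And>x. x \<in> {0..L} \<Longrightarrow>
      ((\<lambda>x. r x * cos (\<theta> x)) has_real_derivative Q x * (r x * sin (\<theta> x)) / \<epsilon>) (at x within {0..L})"
proof -
  define g where "g x = (1 + Q x) * sin (\<theta> x) * cos (\<theta> x) / \<epsilon>" for x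
  define r where "r x = exp (integral {0..x} g)" for x
  have cont\<theta>: "continuous_on {0..L} (\<theta>)"
    using \<theta> by (rule DERIV_continuous_on)
  have contg: "continuous_on {0..L} g"
    unfolding g_def by (intro continuous_intros Q cont\<theta>) (use eps in auto)
  have r': "(r has_real_derivative r x * g x) (at x within {0..L})" if "x \<in> {0..L}" for x
    unfolding r_def by (rule derivative_eq_intros integral_has_real_derivative[OF contg] that refl)+
  show thesis
  proof (rule that[of r])
    show "r 0 = 1" by (simp add: r_def)
    fix x assume x: "x \<in> {0..L}"
    show "((\<lambda>x. r x * sin (\<theta> x)) has_real_derivative r x * cos (\<theta> x) / \<epsilon>) (at x within {0..L})"
    proof (rule derivative_eq_intros r' \<theta> x refl)+
      define s c where "s = sin (\<theta> x)" and "c = cos (\<theta> x)"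
      have "(1 + Q x) * s * c * s + c * (1 - (1 + Q x) * s\<^sup>2) = c"
        by (simp add: power2_eq_square algebra_simps)
      moreover define X where "X = 1 - (1 + Q x) * s\<^sup>2"
      ultimately have id: "(1 + Q x) * s * c * s + c * X = c" by simp
      have "r x * g x * s + c * (X / \<epsilon>) * r x = r x * (((1 + Q x) * s * c * s + c * X) / \<epsilon>)"
        unfolding g_def s_def[symmetric] c_def[symmetric] by (simp add: add_divide_distrib algebra_simps)
      then show "r x * g x * sin (\<theta> x) + cos (\<theta> x) * ((1 - (1 + Q x) * (sin (\<theta> x))\<^sup>2) / \<epsilon>) * r x = r x * cos (\<theta> x) / \<epsilon>"
        unfolding id s_def[symmetric] c_def[symmetric] X_def[symmetric] by simp
    qed
    show "((\<lambda>x. r x * cos (\<theta> x)) has_real_derivative Q x * (r x * sin (\<theta> x)) / \<epsilon>) (at x within {0..L})"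
    proof (rule derivative_eq_intros r' \<theta> x refl)+
      define s c where "s = sin (\<theta> x)" and "c = cos (\<theta> x)"
      have c2: "c * c = 1 - s * s" 
        using sin_cos_squared_add[of "\<theta> x"] by (simp add: s_def c_def power2_eq_square)
      have "(1 + Q x) * s * c * c - s * (1 - (1 + Q x) * s\<^sup>2)
        = s * ((1 + Q x) * (c * c + s * s) - 1)"
        by (simp add: power2_eq_square algebra_simps)
      also have "\<dots> = Q x * s" by (simp add: c2)
      finally have *: "(1 + Q x) * s * c * c - s * (1 - (1 + Q x) * s\<^sup>2) = Q x * s" .
      define X where "X = 1 - (1 + Q x) * s\<^sup>2"
      have id: "(1 + Q x) * s * c * c - s * X = Q x * s" using * by (simp only: X_def)
      have "r x * g x * c + - s * (X / \<epsilon>) * r x = r x * (((1 + Q x) * s * c * c - s * X) / \<epsilon>)"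
        unfolding g_def s_def[symmetric] c_def[symmetric] by (simp add: add_divide_distrib diff_divide_distrib algebra_simps)
      then show "r x * g x * cos (\<theta> x) + - sin (\<theta> x) * ((1 - (1 + Q x) * (sin (\<theta> x))\<^sup>2) / \<epsilon>) * r x = Q x * (r x * sin (\<theta> x)) / \<epsilon>"
        unfolding id s_def[symmetric] c_def[symmetric] X_def[symmetric] by (simp add: algebra_simps)
    qed
  qed
qed

text \<open>The Pruefer angle at \<open>L\<close> depends continuously on \<open>\<mu>\<close>. On \<open>[\<alpha>, \<beta>]\<close> the angle for
  \<open>E - \<eta>\<close> cannot cross \<open>pi / 2 + k * pi\<close> upwards, while the one for \<open>E + \<eta>\<close> gains \<open>3 * pi\<close>. As angles
  are monotone in \<open>\<mu>\<close>, some intermediate \<open>\<mu>\<close> yields a multiple of \<open>pi\<close> at \<open>L\<close>.\<close>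

lemma dirichlet_eigenpair:
  fixes Q :: "real \<Rightarrow> real"
  assumes eps: "0 < \<epsilon>" and ab: "0 \<le> \<alpha>" "\<alpha> < \<beta>" "\<beta> \<le> L"
    and Q: "continuous_on {0..L} Q"
    and near: "\<And>x. x \<in> {\<alpha>..\<beta>} \<Longrightarrow> \<bar>Q x - E\<bar> \<le> \<eta> / 2"
    and eta: "0 < \<eta>" "\<eta> \<le> 1"
    and long: "3 * pi * \<epsilon> \<le> \<eta> / 2 * (\<beta> - \<alpha>)"
  obtains \<mu> \<psi> p where "\<bar>\<mu> - E\<bar> \<le> \<eta>" "\<psi> 0 = 0" "p 0 = 1" "\<psi> L = 0"
    "\<And>x. x \<in> {0..L} \<Longrightarrow> (\<psi> has_real_derivative p x / \<epsilon>) (at x within {0..L})"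
    "\<And>x. x \<in> {0..L} \<Longrightarrow> (p has_real_derivative (Q x - \<mu>) * \<psi> x / \<epsilon>) (at x within {0..L})"
proof -
  define F where "F \<mu> x y = (1 - (1 + (Q x - \<mu>)) * (sin y)\<^sup>2) / \<epsilon>" for \<mu> x y
  obtain M where M: "\<And>x. x \<in> {0..L} \<Longrightarrow> \<bar>Q x\<bar> \<le> M"
    using continuous_on_interval_bound[OF Q] by blast
  \<comment> \<open>This bounds \<open>\<bar>1 + Q x - \<mu>\<bar> / \<epsilon>\<close> for all
    \<open>\<mu>\<close> in the window, so one Lipschitz constant serves every energy.\<close>
  define K where "K = (2 + M + \<bar>E\<bar> + \<eta>) / \<epsilon>"
  have "0 \<le> M" using M[of 0] ab by force
  then have K: "0 < K" using eps eta by (simp add: K_def add_nonneg_pos)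
  have lip: "\<bar>F \<mu> x z - F \<mu> x y\<bar> \<le> K * \<bar>z - y\<bar>"
    if "\<mu> \<in> {E - \<eta>..E + \<eta>}" "x \<in> {0..L}" for \<mu> x y z
  proof -
    have "F \<mu> x z - F \<mu> x y = (1 + (Q x - \<mu>)) / \<epsilon> * ((sin y)\<^sup>2 - (sin z)\<^sup>2)"
      using eps by (simp add: F_def field_simps)
    also have "\<bar>\<dots>\<bar> \<le> K * \<bar>z - y\<bar>"
      unfolding abs_mult
    proof (rule mult_mono)
      show "\<bar>(1 + (Q x - \<mu>)) / \<epsilon>\<bar> \<le> K"
        using M[of x] that eps by (auto simp: K_def abs_divide intro!: divide_right_mono)
      show "\<bar>(sin y)\<^sup>2 - (sin z)\<^sup>2\<bar> \<le> \<bar>z - y\<bar>"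
        using sin_squared_lipschitz[of y z] by simp
    qed (use K in auto)
    finally show ?thesis .
  qed
  have "\<exists>u. u 0 = 0 \<and> (\<forall>x\<in>{0..L}. (u has_real_derivative F \<mu> x (u x)) (at x within {0..L}))"
    if mu: "\<mu> \<in> {E - \<eta>..E + \<eta>}" for \<mu>
  proof -
    have contF: "continuous_on ({0..L} \<times> UNIV) (\<lambda>(x, y). F \<mu> x y)"
      unfolding F_def case_prod_unfold
      by (intro continuous_intros continuous_on_compose2[OF Q]) (use eps in auto)
    have "0 \<le> L" using ab by simp
    from ode_exists[OF this K contF lip[OF mu]] obtain u where "u 0 = 0"
      "\<And>x. x \<in> {0..L} \<Longrightarrow> (u has_real_derivative F \<mu> x (u x)) (at x within {0..L})"
      by blast
    then show ?thesis by blast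
  qed
  then have "\<forall>\<mu>\<in>{E - \<eta>..E + \<eta>}. \<exists>u. u 0 = 0 \<and>
      (\<forall>x\<in>{0..L}. (u has_real_derivative F \<mu> x (u x)) (at x within {0..L}))"
    by blast
  from bchoice[OF this] obtain \<theta> where
    \<theta>: "\<forall>\<mu>\<in>{E - \<eta>..E + \<eta>}. \<theta> \<mu> 0 = 0 \<and>
      (\<forall>x\<in>{0..L}. (\<theta> \<mu> has_real_derivative F \<mu> x (\<theta> \<mu> x)) (at x within {0..L}))" ..
  then have \<theta>0: "\<And>\<mu>. \<mu> \<in> {E - \<eta>..E + \<eta>} \<Longrightarrow> \<theta> \<mu> 0 = 0"
    and \<theta>L: "\<And>\<mu> x. \<mu> \<in> {E - \<eta>..E + \<eta>} \<Longrightarrow> x \<in> {0..L} \<Longrightarrow>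
      (\<theta> \<mu> has_real_derivative F \<mu> x (\<theta> \<mu> x)) (at x within {0..L})"
    by blast+
  have \<theta>': "(\<theta> \<mu> has_real_derivative F \<mu> x (\<theta> \<mu> x)) (at x within {c..d})"
    if "\<mu> \<in> {E - \<eta>..E + \<eta>}" "0 \<le> c" "d \<le> L" "x \<in> {c..d}" for \<mu> x c d
    using \<theta>L[of \<mu> x] that by (intro DERIV_subset[OF \<theta>L]) auto
  have Fmono: "F \<mu> x y \<le> F \<nu> x y" "F \<nu> x y \<le> F \<mu> x y + (\<nu> - \<mu>) / \<epsilon>" if "\<mu> \<le> \<nu>" for \<mu> \<nu> x y
  proof -
    have F: "F \<nu> x y = F \<mu> x y + (\<nu> - \<mu>) * (sin y)\<^sup>2 / \<epsilon>"
      using eps by (simp add: F_def field_simps)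
    have "(\<nu> - \<mu>) * (sin y)\<^sup>2 \<le> (\<nu> - \<mu>) * 1"
      using that by (intro mult_left_mono) (auto simp: abs_square_le_1)
    then show "F \<mu> x y \<le> F \<nu> x y" "F \<nu> x y \<le> F \<mu> x y + (\<nu> - \<mu>) / \<epsilon>"
      using that eps by (auto simp: F divide_right_mono)
  qed
  have mono: "\<theta> \<mu> x \<le> \<theta> \<nu> x"
    if "\<mu> \<in> {E - \<eta>..E + \<eta>}" "\<nu> \<in> {E - \<eta>..E + \<eta>}" "\<mu> \<le> \<nu>" "x \<in> {0..L}" for \<mu> \<nu> x
  proof (rule ode_comparison[where F = "F \<nu>" and K = K and a = 0 and b = x and u = "\<theta> \<mu>" and v = "\<theta> \<nu>"])
    show "(\<theta> \<mu> has_real_derivative F \<mu> y (\<theta> \<mu> y)) (at y within {0..x})"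
      "(\<theta> \<nu> has_real_derivative F \<nu> y (\<theta> \<nu> y)) (at y within {0..x})" if "y \<in> {0..x}" for y
      using \<open>x \<in> {0..L}\<close> \<open>\<mu> \<in> _\<close> \<open>\<nu> \<in> _\<close> that by (auto intro!: \<theta>')
  qed (use that Fmono lip \<theta>0 in auto)
  \<comment> \<open>The added term solves \<open>D' = K * D + (\<nu> - \<mu>) / \<epsilon>\<close>
    with \<open>D 0 = 0\<close>, which makes \<open>\<theta> \<mu> + D\<close> a supersolution for
    \<open>\<nu>\<close>. This is the Lipschitz dependence on the energy.\<close>
  have step: "\<theta> \<nu> L \<le> \<theta> \<mu> L + (exp (K * L) - 1) / (K * \<epsilon>) * (\<nu> - \<mu>)"
    if "\<mu> \<in> {E - \<eta>..E + \<eta>}" "\<nu> \<in> {E - \<eta>..E + \<eta>}" "\<mu> \<le> \<nu>" for \<mu> \<nu>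
  proof (rule ode_comparison[where F = "F \<nu>" and K = K and a = 0 and b = L and u = "\<theta> \<nu>"
        and v = "\<lambda>x. \<theta> \<mu> x + (exp (K * x) - 1) / (K * \<epsilon>) * (\<nu> - \<mu>)"])
    fix x assume x: "x \<in> {0..L}"
    show "(\<theta> \<nu> has_real_derivative F \<nu> x (\<theta> \<nu> x)) (at x within {0..L})"
      using \<theta>L that x by auto
    show "((\<lambda>x. \<theta> \<mu> x + (exp (K * x) - 1) / (K * \<epsilon>) * (\<nu> - \<mu>)) has_real_derivative
       F \<mu> x (\<theta> \<mu> x) + exp (K * x) * (\<nu> - \<mu>) / \<epsilon>) (at x within {0..L})"
    proof (rule DERIV_add[OF \<theta>L[OF that(1) x]])
      show "((\<lambda>x. (exp (K * x) - 1) / (K * \<epsilon>) * (\<nu> - \<mu>)) has_real_derivative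
          exp (K * x) * (\<nu> - \<mu>) / \<epsilon>) (at x within {0..L})"
        using K eps by (auto intro!: derivative_eq_intros simp: field_simps)
    qed
    define D where "D = (exp (K * x) - 1) / (K * \<epsilon>) * (\<nu> - \<mu>)"
    have D: "0 \<le> D" "K * D = (exp (K * x) - 1) * (\<nu> - \<mu>) / \<epsilon>"
      using K eps that x by (auto simp: D_def)
    have "F \<nu> x (\<theta> \<mu> x + D) \<le> F \<nu> x (\<theta> \<mu> x) + K * D"
      using lip[OF that(2) x, of "\<theta> \<mu> x + D" "\<theta> \<mu> x"] D by simp
    also have "\<dots> \<le> F \<mu> x (\<theta> \<mu> x) + (\<nu> - \<mu>) / \<epsilon> + K * D"
      using Fmono[OF that(3)] by simp
    also have "\<dots> = F \<mu> x (\<theta> \<mu> x) + exp (K * x) * (\<nu> - \<mu>) / \<epsilon>"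
      unfolding D(2) using eps by (simp add: field_simps)
    finally show "F \<nu> x (\<theta> \<mu> x + (exp (K * x) - 1) / (K * \<epsilon>) * (\<nu> - \<mu>))
        \<le> F \<mu> x (\<theta> \<mu> x) + exp (K * x) * (\<nu> - \<mu>) / \<epsilon>"
      by (simp add: D_def)
  qed (use ab lip[OF that(2)] \<theta>0 that in auto)
  define C where "C = (exp (K * L) - 1) / (K * \<epsilon>)"
  have "C-lipschitz_on {E - \<eta>..E + \<eta>} (\<lambda>\<mu>. \<theta> \<mu> L)"
  proof (rule lipschitz_onI)
    show "0 \<le> C" using ab K eps by (simp add: C_def)
    show "dist (\<theta> \<mu> L) (\<theta> \<nu> L) \<le> C * dist \<mu> \<nu>"
      if "\<mu> \<in> {E - \<eta>..E + \<eta>}" "\<nu> \<in> {E - \<eta>..E + \<eta>}" for \<mu> \<nu>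
    proof (cases "\<mu> \<le> \<nu>")
      case True
      then show ?thesis
        using mono[OF that True, of L] step[OF that True] ab by (simp add: dist_real_def C_def)
    next
      case False
      then show ?thesis
        using mono[OF that(2,1), of L] step[OF that(2,1)] ab by (simp add: dist_real_def C_def)
    qed
  qed
  then have contL: "continuous_on {E - \<eta>..E + \<eta>} (\<lambda>\<mu>. \<theta> \<mu> L)"
    by (rule lipschitz_on_continuous_on)
  define lo where "lo = E - \<eta>"
  define hi where "hi = E + \<eta>"
  have mem: "lo \<in> {E - \<eta>..E + \<eta>}" "hi \<in> {E - \<eta>..E + \<eta>}" "lo \<le> hi"
    using eta by (auto simp: lo_def hi_def)
  \<comment> \<open>Here \<open>Q x - hi \<le> - \<eta> / 2\<close>, and
    \<open>\<eta> \<le> 1\<close> keeps \<open>1 - \<eta> / 2\<close> nonnegative, so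
    \<open>sin\<^sup>2\<close> may be replaced by \<open>1\<close>: the slope of the angle is at
    least \<open>\<eta> / (2 * \<epsilon>)\<close>.\<close>
  have hi_grow: "\<theta> hi \<alpha> + 3 * pi \<le> \<theta> hi \<beta>"
  proof -
    have "\<theta> hi \<alpha> - \<eta> / 2 / \<epsilon> * \<alpha> \<le> \<theta> hi \<beta> - \<eta> / 2 / \<epsilon> * \<beta>"
    proof (rule has_real_derivative_nonneg_imp_le[where f = "\<lambda>x. \<theta> hi x - \<eta> / 2 / \<epsilon> * x"])
      fix x assume x: "x \<in> {\<alpha>..\<beta>}"
      show "((\<lambda>x. \<theta> hi x - \<eta> / 2 / \<epsilon> * x) has_real_derivative F hi x (\<theta> hi x) - \<eta> / 2 / \<epsilon>) (at x within {\<alpha>..\<beta>})"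
        by (rule derivative_eq_intros \<theta>' mem x ab refl)+ simp
      have "(1 + (Q x - hi)) * (sin (\<theta> hi x))\<^sup>2 \<le> (1 - \<eta> / 2) * 1"
      proof (rule mult_mono)
        show "1 + (Q x - hi) \<le> 1 - \<eta> / 2"
          using near[OF x] unfolding hi_def abs_le_iff by linarith
      qed (use eta in \<open>auto simp: abs_square_le_1\<close>)
      moreover have "F hi x (\<theta> hi x) - \<eta> / 2 / \<epsilon> =
          (1 - (1 + (Q x - hi)) * (sin (\<theta> hi x))\<^sup>2 - \<eta> / 2) / \<epsilon>"
        by (simp add: F_def diff_divide_distrib)
      ultimately show "0 \<le> F hi x (\<theta> hi x) - \<eta> / 2 / \<epsilon>"
        using eps by simp
    qed (use ab in simp)
    moreover have "3 * pi \<le> \<eta> / 2 / \<epsilon> * (\<beta> - \<alpha>)"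
      using long eps by (simp add: field_simps)
    ultimately show ?thesis unfolding right_diff_distrib by linarith
  qed
  have lo_barrier: "\<theta> lo \<beta> \<le> \<theta> lo \<alpha> + pi"
  proof -
    \<comment> \<open>\<open>B\<close> is the first point of \<open>pi / 2 + pi * \<int>\<close> not
      below the angle at \<open>\<alpha>\<close>. There \<open>sin\<^sup>2 = 1\<close> and the
      right-hand side equals \<open>- (Q x - lo) / \<epsilon> \<le> 0\<close>, so the constant
      \<open>B\<close> is a supersolution.\<close>
    define k where "k = \<lceil>(\<theta> lo \<alpha> - pi / 2) / pi\<rceil>"
    define B where "B = pi / 2 + of_int k * pi"
    have k: "(\<theta> lo \<alpha> - pi / 2) / pi \<le> of_int k" "of_int k < (\<theta> lo \<alpha> - pi / 2) / pi + 1"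
      unfolding k_def by linarith+
    then have B: "\<theta> lo \<alpha> \<le> B" "B \<le> \<theta> lo \<alpha> + pi"
      by (auto simp: B_def field_simps)
    have "(cos (of_int k * pi))\<^sup>2 = 1"
      using sin_zero_iff_int2[of "of_int k * pi"] by (auto simp: cos_squared_eq)
    then have sin1: "(sin B)\<^sup>2 = 1" by (simp add: B_def sin_add)
    have "\<theta> lo \<beta> \<le> B"
    proof (rule ode_comparison[where F = "F lo" and K = K and a = \<alpha> and b = \<beta> and u = "\<theta> lo" and v = "\<lambda>_. B" and v' = "\<lambda>_. 0"])
      fix x assume x: "x \<in> {\<alpha>..\<beta>}"
      show "(\<theta> lo has_real_derivative F lo x (\<theta> lo x)) (at x within {\<alpha>..\<beta>})"
        by (rule \<theta>' mem x ab)+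
      show "F lo x B \<le> 0"
      proof -
        have "Q x - lo \<ge> 0"
          using near[OF x] eta unfolding lo_def abs_le_iff by linarith
        then show ?thesis
          using eps by (simp add: F_def sin1 divide_le_0_iff)
      qed
    qed (use ab B lip[OF mem(1)] in auto)
    with B show ?thesis by simp
  qed
  \<comment> \<open>The right-hand side is periodic in the angle, so
    \<open>\<theta> lo + 2 * pi\<close> solves the same equation as \<open>\<theta> lo\<close>. The
    gap \<open>3 * pi - pi\<close> present at \<open>\<beta>\<close> therefore persists up to
    \<open>L\<close>.\<close>
  have "\<theta> lo L + 2 * pi \<le> \<theta> hi L"
  proof (rule ode_comparison[where F = "F hi" and K = K and a = \<beta> and b = L and u = "\<lambda>x. \<theta> lo x + 2 * pi" and v = "\<theta> hi"])
    fix x assume x: "x \<in> {\<beta>..L}"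
    have \<beta>0: "0 \<le> \<beta>" using ab by simp
    show "((\<lambda>x. \<theta> lo x + 2 * pi) has_real_derivative F lo x (\<theta> lo x)) (at x within {\<beta>..L})"
      by (rule derivative_eq_intros \<theta>' mem x \<beta>0 order_refl refl)+ simp
    show "(\<theta> hi has_real_derivative F hi x (\<theta> hi x)) (at x within {\<beta>..L})"
      by (rule \<theta>' mem x \<beta>0 order_refl)+
    show "F lo x (\<theta> lo x) \<le> F hi x (\<theta> lo x + 2 * pi)"
      using Fmono(1)[OF mem(3)] by (simp add: F_def)
  next
    show "\<theta> lo \<beta> + 2 * pi \<le> \<theta> hi \<beta>"
      using hi_grow lo_barrier mono[OF mem, of \<alpha>] ab by simp
  qed (use ab lip[OF mem(2)] in auto)
  \<comment> \<open>Some multiple of \<open>pi\<close> lies at most \<open>pi\<close> above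
    \<open>\<theta> lo L\<close>, hence between the two angles at \<open>L\<close>.\<close>
  moreover define k where "k = \<lceil>\<theta> lo L / pi\<rceil>"
  have "\<theta> lo L / pi \<le> of_int k" "of_int k < \<theta> lo L / pi + 1"
    unfolding k_def by linarith+
  then have "\<theta> lo L \<le> of_int k * pi" "of_int k * pi \<le> \<theta> lo L + pi"
    by (auto simp: field_simps)
  ultimately have "\<exists>\<mu>\<ge>lo. \<mu> \<le> hi \<and> \<theta> \<mu> L = of_int k * pi"
    using mem contL by (intro IVT') (auto simp: lo_def hi_def)
  then obtain \<mu> where \<mu>: "\<mu> \<in> {E - \<eta>..E + \<eta>}" "\<theta> \<mu> L = of_int k * pi"
    by (auto simp: lo_def hi_def)
  have "((\<lambda>x. \<theta> \<mu> x) has_real_derivative (1 - (1 + (Q x - \<mu>)) * (sin (\<theta> \<mu> x))\<^sup>2) / \<epsilon>) (at x within {0..L})"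
    if "x \<in> {0..L}" for x
    using \<theta>L[OF \<mu>(1) that] by (simp add: F_def)
  from pruefer_amplitude[OF eps _ this, OF continuous_on_diff[OF Q continuous_on_const]] obtain r where r: "r 0 = 1"
    "\<And>x. x \<in> {0..L} \<Longrightarrow>
      ((\<lambda>x. r x * sin (\<theta> \<mu> x)) has_real_derivative r x * cos (\<theta> \<mu> x) / \<epsilon>) (at x within {0..L})"
    "\<And>x. x \<in> {0..L} \<Longrightarrow>
      ((\<lambda>x. r x * cos (\<theta> \<mu> x)) has_real_derivative (Q x - \<mu>) * (r x * sin (\<theta> \<mu> x)) / \<epsilon>) (at x within {0..L})"
    by blast
  show thesis
  proof (rule that[OF _ _ _ _ r(2,3)])
    show "\<bar>\<mu> - E\<bar> \<le> \<eta>" using \<mu> by auto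
    show "r L * sin (\<theta> \<mu> L) = 0"
      using \<mu>(2) sin_zero_iff_int2 by simp
    show "r 0 * sin (\<theta> \<mu> 0) = 0" "r 0 * cos (\<theta> \<mu> 0) = 1"
      using \<theta>0[OF \<mu>(1)] r(1) by auto
  qed
qed

section \<open>Agmon estimates for the eigenfunctions\<close>

lemma two_mult_le_sum_squares_div:
  fixes p y k :: real
  assumes "0 < k"
  shows "2 * \<bar>p * y\<bar> \<le> (p\<^sup>2 + k * y\<^sup>2) / sqrt k"
proof -
  have "0 \<le> (\<bar>p\<bar> - sqrt k * \<bar>y\<bar>)\<^sup>2" by simp
  then have "2 * \<bar>p * y\<bar> * sqrt k \<le> p\<^sup>2 + k * y\<^sup>2"
    using assms by (simp add: power2_diff power_mult_distrib abs_mult algebra_simps)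
  then show ?thesis using assms by (simp add: le_divide_eq)
qed

text \<open>Up to the factor \<open>1 / \<epsilon>\<close>, the quotient in the last bound is the
  growth rate of an energy with weight \<open>k\<close>. For \<open>t \<le> 0\<close> the sum
  \<open>k + t\<close> nearly cancels and leaves a multiple of \<open>sqrt \<eta>\<close>; for
  \<open>t > 0\<close> it is close to \<open>2 * t\<close> and gives the Agmon rate
  \<open>2 * sqrt t\<close>.\<close>

lemma sqrt_sum_squares_bounds:
  fixes t \<eta> :: real
  assumes "0 < \<eta>"
  defines "k \<equiv> sqrt (t\<^sup>2 + \<eta>\<^sup>2)"
  shows "\<eta> \<le> k" "\<bar>t\<bar> \<le> k" "k \<le> \<bar>t\<bar> + \<eta>" "(k + t) / sqrt k \<le> 2 * sqrt (max t 0) + 2 * sqrt \<eta>"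
proof -
  have k2: "k\<^sup>2 = t\<^sup>2 + \<eta>\<^sup>2" by (simp add: k_def)
  show k\<eta>: "\<eta> \<le> k"
    unfolding k_def by (rule real_le_rsqrt) simp
  show tk: "\<bar>t\<bar> \<le> k"
    unfolding k_def by (rule real_le_rsqrt) simp
  show kt: "k \<le> \<bar>t\<bar> + \<eta>"
  proof (rule power2_le_imp_le)
    show "k\<^sup>2 \<le> (\<bar>t\<bar> + \<eta>)\<^sup>2" using assms(1) by (simp add: k2 power2_sum)
  qed (use assms(1) in simp)
  have k0: "0 < k" using k\<eta> assms(1) by simp
  show "(k + t) / sqrt k \<le> 2 * sqrt (max t 0) + 2 * sqrt \<eta>"
  proof (cases "t \<le> 0")
    case True
    then have "k + t \<le> \<eta>" using kt by simp
    then have "(k + t) / sqrt k \<le> \<eta> / sqrt \<eta>"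
      using k\<eta> assms(1) True tk by (intro frac_le) auto
    also have "\<dots> = sqrt \<eta>" using assms(1) by (simp add: real_div_sqrt)
    also have "\<dots> \<le> 2 * sqrt (max t 0) + 2 * sqrt \<eta>"
      using assms(1) True by simp
    finally show ?thesis .
  next
    case False
    then have "(k + t) / sqrt k \<le> 2 * k / sqrt k"
      using tk k0 by (intro divide_right_mono) auto
    also have "\<dots> = 2 * sqrt k" using k0 real_div_sqrt[of k] by simp
    also have "\<dots> \<le> 2 * sqrt (t + \<eta>)" using kt False by simp
    also have "\<dots> \<le> 2 * (sqrt t + sqrt \<eta>)"
      using sqrt_add_le_add_sqrt[of t \<eta>] False assms(1) by simp
    finally show ?thesis using False by simp
  qed
qed

lemma sqrt_sum_squares_deriv:
  fixes t :: "real \<Rightarrow> real"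
  assumes "(t has_real_derivative t') (at x within S)" "0 < \<eta>"
  shows "((\<lambda>x. sqrt ((t x)\<^sup>2 + \<eta>\<^sup>2)) has_real_derivative t x * t' / sqrt ((t x)\<^sup>2 + \<eta>\<^sup>2)) (at x within S)"
proof -
  have "0 < (t x)\<^sup>2 + \<eta>\<^sup>2" using assms(2) by (simp add: add_nonneg_pos)
  then show ?thesis
    by (auto intro!: derivative_eq_intros assms(1) simp: field_simps)
qed

text \<open>The weight \<open>k\<close> is a smooth substitute for \<open>\<bar>t\<bar>\<close>: it makes the energy almost constant
  where \<open>t < 0\<close> and lets it grow at most at the Agmon rate where \<open>t > 0\<close>.\<close>

lemma energy_deriv_bound:
  fixes \<psi> p t Q :: "real \<Rightarrow> real"
  assumes eps: "0 < \<epsilon>" and eta: "0 < \<eta>"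
    and \<psi>: "(\<psi> has_real_derivative p x / \<epsilon>) (at x within S)"
    and p: "(p has_real_derivative Q x * \<psi> x / \<epsilon>) (at x within S)"
    and t: "(t has_real_derivative t') (at x within S)"
    and A: "\<bar>t'\<bar> \<le> A" "\<epsilon> * A \<le> \<eta> * sqrt \<eta>"
    and Q: "\<bar>Q x - t x\<bar> \<le> 2 * \<eta>"
  defines "n \<equiv> \<lambda>x. (p x)\<^sup>2 + sqrt ((t x)\<^sup>2 + \<eta>\<^sup>2) * (\<psi> x)\<^sup>2"
  obtains n' where "(n has_real_derivative n') (at x within S)"
    "\<bar>n'\<bar> \<le> (2 * sqrt (max (t x) 0) + 5 * sqrt \<eta>) / \<epsilon> * n x"
proof -
  define k where "k x = sqrt ((t x)\<^sup>2 + \<eta>\<^sup>2)" for x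
  have k: "\<eta> \<le> k x" "\<bar>t x\<bar> \<le> k x" "k x \<le> \<bar>t x\<bar> + \<eta>"
      "(k x + t x) / sqrt (k x) \<le> 2 * sqrt (max (t x) 0) + 2 * sqrt \<eta>"
    using sqrt_sum_squares_bounds[OF eta, of "t x"] by (auto simp: k_def)
  then have k0: "0 < k x" using eta by simp
  have n: "n x = (p x)\<^sup>2 + k x * (\<psi> x)\<^sup>2" for x by (simp add: n_def k_def)
  define k' where "k' = t x * t' / k x"
  have k': "(k has_real_derivative k') (at x within S)"
    unfolding k_def k'_def by (rule sqrt_sum_squares_deriv[OF t eta])
  have "\<bar>k'\<bar> \<le> A"
  proof -
    have "\<bar>t x\<bar> * \<bar>t'\<bar> \<le> k x * A" using k A by (intro mult_mono) auto
    then show ?thesis using k0 by (simp add: k'_def abs_mult divide_le_eq mult.commute)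
  qed
  \<comment> \<open>Differentiating \<open>p\<^sup>2\<close> and \<open>\<psi>\<^sup>2\<close>
    yields the common factor \<open>p * \<psi>\<close> with coefficient \<open>k + Q\<close>, which
    is small where \<open>t < 0\<close> because there \<open>k\<close> is close to
    \<open>- t\<close> and \<open>Q\<close> to \<open>t\<close>.\<close>
  define n' where "n' = k' * (\<psi> x)\<^sup>2 + 2 * (p x * \<psi> x) * (k x + Q x) / \<epsilon>"
  have "(n has_real_derivative n') (at x within S)"
    unfolding n[abs_def] n'_def
    by (rule derivative_eq_intros \<psi> p k' refl)+ (simp add: field_simps add_divide_distrib)
  \<comment> \<open>The constant is \<open>5 = 1 + 2 + 2\<close>: one \<open>sqrt \<eta>\<close> for
    \<open>k'\<close>, controlled by \<open>\<epsilon> * A \<le> \<eta> * sqrt \<eta>\<close> and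
    \<open>\<eta> * \<psi>\<^sup>2 \<le> n\<close>, two for the smoothing of
    \<open>\<bar>t\<bar>\<close>, two for \<open>Q - t\<close>.\<close>
  moreover have "\<bar>n'\<bar> \<le> (2 * sqrt (max (t x) 0) + 5 * sqrt \<eta>) / \<epsilon> * n x"
  proof -
    have n0: "0 \<le> n x" using k0 by (simp add: n)
    have "\<bar>k' * (\<psi> x)\<^sup>2\<bar> \<le> sqrt \<eta> / \<epsilon> * n x"
    proof -
      have "\<bar>k'\<bar> * (\<psi> x)\<^sup>2 \<le> \<eta> * sqrt \<eta> / \<epsilon> * (\<psi> x)\<^sup>2"
      proof (rule mult_right_mono)
        have "\<epsilon> * \<bar>k'\<bar> \<le> \<epsilon> * A" using \<open>\<bar>k'\<bar> \<le> A\<close> eps by simp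
        then have "\<epsilon> * \<bar>k'\<bar> \<le> \<eta> * sqrt \<eta>" using A(2) by (rule order_trans)
        then show "\<bar>k'\<bar> \<le> \<eta> * sqrt \<eta> / \<epsilon>"
          using eps by (simp add: le_divide_eq mult.commute)
      qed simp
      also have "\<dots> = sqrt \<eta> / \<epsilon> * (\<eta> * (\<psi> x)\<^sup>2)" by simp
      also have "\<dots> \<le> sqrt \<eta> / \<epsilon> * n x"
      proof (rule mult_left_mono)
        have "\<eta> * (\<psi> x)\<^sup>2 \<le> k x * (\<psi> x)\<^sup>2" using k by (intro mult_right_mono) auto
        then show "\<eta> * (\<psi> x)\<^sup>2 \<le> n x" by (simp add: n add_increasing)
      qed (use eta eps in auto)
      finally show ?thesis by (simp add: abs_mult)
    qed
    moreover have "\<bar>2 * (p x * \<psi> x) * (k x + Q x) / \<epsilon>\<bar> \<le> (2 * sqrt (max (t x) 0) + 4 * sqrt \<eta>) / \<epsilon> * n x"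
    proof -
      have kQ: "\<bar>k x + Q x\<bar> \<le> k x + t x + 2 * \<eta>" using Q k by linarith
      have "\<bar>2 * (p x * \<psi> x) * (k x + Q x)\<bar> \<le> n x / sqrt (k x) * (k x + t x + 2 * \<eta>)"
        unfolding abs_mult[of _ "k x + Q x"]
        using two_mult_le_sum_squares_div[OF k0, of "p x" "\<psi> x"] kQ
        by (intro mult_mono) (use n0 k0 in \<open>auto simp: n abs_mult\<close>)
      also have "\<dots> = n x * ((k x + t x) / sqrt (k x) + 2 * \<eta> / sqrt (k x))"
        by (simp add: add_divide_distrib algebra_simps)
      also have "\<dots> \<le> n x * (2 * sqrt (max (t x) 0) + 4 * sqrt \<eta>)"
      proof (intro mult_left_mono n0)
        have "2 * \<eta> / sqrt (k x) \<le> 2 * \<eta> / sqrt \<eta>"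
          using k eta by (intro frac_le) auto
        also have "\<dots> = 2 * sqrt \<eta>" using eta real_div_sqrt[of \<eta>] by simp
        finally show "(k x + t x) / sqrt (k x) + 2 * \<eta> / sqrt (k x) \<le> 2 * sqrt (max (t x) 0) + 4 * sqrt \<eta>"
          using k(4) by linarith
      qed
      finally have "\<bar>2 * (p x * \<psi> x) * (k x + Q x)\<bar> / \<epsilon> \<le> n x * (2 * sqrt (max (t x) 0) + 4 * sqrt \<eta>) / \<epsilon>"
        using eps by (intro divide_right_mono) auto
      then show ?thesis using eps by (simp add: mult.commute)
    qed
    ultimately have "\<bar>n'\<bar> \<le> sqrt \<eta> / \<epsilon> * n x + (2 * sqrt (max (t x) 0) + 4 * sqrt \<eta>) / \<epsilon> * n x"
      unfolding n'_def by linarith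
    also have "\<dots> = (2 * sqrt (max (t x) 0) + 5 * sqrt \<eta>) / \<epsilon> * n x"
      by (simp add: add_divide_distrib algebra_simps)
    finally show ?thesis .
  qed
  ultimately show thesis by (rule that)
qed

text \<open>In the forbidden region the Dirichlet condition at \<open>0\<close> keeps \<open>p * \<psi>\<close> nonnegative, so the
  component \<open>p + sqrt k * \<psi>\<close> growing at the Agmon rate controls \<open>\<psi>\<close>.\<close>

lemma forbidden_region_growth:
  fixes \<psi> p t Q :: "real \<Rightarrow> real"
  assumes eps: "0 < \<epsilon>" and eta: "0 < \<eta>" and s: "0 \<le> s"
    and \<psi>: "\<And>x. x \<in> {0..s} \<Longrightarrow> (\<psi> has_real_derivative p x / \<epsilon>) (at x within {0..s})"
    and p: "\<And>x. x \<in> {0..s} \<Longrightarrow> (p has_real_derivative Q x * \<psi> x / \<epsilon>) (at x within {0..s})"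
    and t: "\<And>x. x \<in> {0..s} \<Longrightarrow> (t has_real_derivative t' x) (at x within {0..s})"
    and A: "\<And>x. x \<in> {0..s} \<Longrightarrow> \<bar>t' x\<bar> \<le> A" "\<epsilon> * A \<le> \<eta> * sqrt \<eta>"
    and Q: "\<And>x. x \<in> {0..s} \<Longrightarrow> \<bar>Q x - t x\<bar> \<le> 2 * \<eta>"
    and forb: "\<And>x. x \<in> {0..s} \<Longrightarrow> 2 * \<eta> \<le> t x"
    and init: "\<psi> 0 = 0" "p 0 = 1"
    and G: "\<And>x. x \<in> {0..s} \<Longrightarrow>
      (G has_real_derivative (2 * sqrt (max (t x) 0) - 7 * sqrt \<eta>) / \<epsilon>) (at x within {0..s})"
  defines "n \<equiv> \<lambda>x. (p x)\<^sup>2 + sqrt ((t x)\<^sup>2 + \<eta>\<^sup>2) * (\<psi> x)\<^sup>2"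
  shows "exp (G s - G 0) / 2 \<le> n s"
proof -
  define k where "k x = sqrt ((t x)\<^sup>2 + \<eta>\<^sup>2)" for x
  have k: "\<eta> \<le> k x" "\<bar>t x\<bar> \<le> k x" "k x \<le> \<bar>t x\<bar> + \<eta>" for x
    using sqrt_sum_squares_bounds[OF eta, of "t x"] by (auto simp: k_def)
  then have k0: "0 < k x" for x using eta less_le_trans by blast
  define k' where "k' x = t x * t' x / k x" for x
  have k': "(k has_real_derivative k' x) (at x within {0..s})" if "x \<in> {0..s}" for x
    unfolding k_def k'_def by (rule sqrt_sum_squares_deriv[OF t[OF that] eta])
  have k'A: "\<bar>k' x\<bar> \<le> A" if "x \<in> {0..s}" for x
  proof -
    have "\<bar>t x\<bar> * \<bar>t' x\<bar> \<le> k x * A" using k[of x] A that by (intro mult_mono) auto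
    then show ?thesis using k0[of x] by (simp add: k'_def abs_mult divide_le_eq mult.commute)
  qed
  define \<kappa> where "\<kappa> x = sqrt (k x)" for x
  have \<kappa>0: "0 < \<kappa> x" and \<kappa>2: "(\<kappa> x)\<^sup>2 = k x" and \<kappa>\<eta>: "sqrt \<eta> \<le> \<kappa> x" for x
    using k0[of x] k(1)[of x] by (auto simp: \<kappa>_def)
  define \<kappa>' where "\<kappa>' x = k' x / (2 * \<kappa> x)" for x
  have \<kappa>': "(\<kappa> has_real_derivative \<kappa>' x) (at x within {0..s})" if "x \<in> {0..s}" for x
    unfolding \<kappa>_def \<kappa>'_def using k0[of x]
    by (auto intro!: derivative_eq_intros k' that simp: field_simps)
  \<comment> \<open>The derivative of \<open>p * \<psi>\<close> is
    \<open>(Q * \<psi>\<^sup>2 + p\<^sup>2) / \<epsilon>\<close>, and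
    \<open>t \<ge> 2 * \<eta>\<close> is exactly what forces \<open>Q \<ge> 0\<close>.\<close>
  have F: "0 \<le> p x * \<psi> x" if x: "x \<in> {0..s}" for x
  proof -
    have "p 0 * \<psi> 0 \<le> p x * \<psi> x"
    proof (rule has_real_derivative_nonneg_imp_le[where f = "\<lambda>x. p x * \<psi> x"])
      fix y assume y: "y \<in> {0..x}"
      then have ys: "y \<in> {0..s}" "{0..x} \<subseteq> {0..s}" using x by auto
      show "((\<lambda>x. p x * \<psi> x) has_real_derivative Q y * \<psi> y / \<epsilon> * \<psi> y + p y / \<epsilon> * p y) (at y within {0..x})"
        by (rule DERIV_mult DERIV_subset[OF \<psi>] DERIV_subset[OF p] ys)+
      have "0 \<le> Q y" using Q[OF ys(1)] forb[OF ys(1)] by linarith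
      then have "0 \<le> Q y * (\<psi> y)\<^sup>2 / \<epsilon> + (p y)\<^sup>2 / \<epsilon>"
        using eps by simp
      then show "0 \<le> Q y * \<psi> y / \<epsilon> * \<psi> y + p y / \<epsilon> * p y"
        by (simp add: power2_eq_square algebra_simps)
    qed (use x in simp)
    then show ?thesis by (simp add: init)
  qed
  \<comment> \<open>For constant coefficients \<open>z\<close> is the growing mode. Since
    \<open>p * \<psi> \<ge> 0\<close>, its two summands do not cancel, so
    \<open>\<kappa> * \<bar>\<psi>\<bar> \<le> \<bar>z\<bar>\<close>.\<close>
  define z where "z x = p x + \<kappa> x * \<psi> x" for x
  define z' where "z' x = Q x * \<psi> x / \<epsilon> + (\<kappa>' x * \<psi> x + p x / \<epsilon> * \<kappa> x)" for x
  have z': "(z has_real_derivative z' x) (at x within {0..s})" if "x \<in> {0..s}" for x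
    unfolding z_def z'_def by (rule DERIV_add DERIV_mult \<kappa>' \<psi> p that)+
  have "(z 0)\<^sup>2 * exp (G s - G 0) \<le> (z s)\<^sup>2"
  proof (rule gronwall_exp[where G = G and n = "\<lambda>x. (z x)\<^sup>2"])
    fix x assume x: "x \<in> {0..s}"
    show "((\<lambda>x. (z x)\<^sup>2) has_real_derivative 2 * z x * z' x) (at x within {0..s})"
      by (rule derivative_eq_intros z' x refl)+ simp
    have z2: "(\<kappa> x * \<psi> x)\<^sup>2 \<le> (z x)\<^sup>2"
    proof -
      have "0 \<le> \<kappa> x * (p x * \<psi> x)" using F[OF x] \<kappa>0[of x] by simp
      then have "0 \<le> (p x)\<^sup>2 + 2 * (\<kappa> x * (p x * \<psi> x))" by (simp add: add_nonneg_nonneg)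
      then show ?thesis by (simp add: z_def power2_sum algebra_simps)
    qed
    have \<psi>z: "\<bar>\<psi> x * z x\<bar> \<le> (z x)\<^sup>2 / \<kappa> x"
    proof -
      have "\<bar>\<kappa> x * \<psi> x\<bar> \<le> \<bar>z x\<bar>" using z2 abs_le_square_iff by blast
      then have "\<bar>\<kappa> x * \<psi> x\<bar> * \<bar>z x\<bar> \<le> \<bar>z x\<bar> * \<bar>z x\<bar>" by (rule mult_right_mono) simp
      then show ?thesis using \<kappa>0[of x]
        by (simp add: le_divide_eq abs_mult power2_eq_square algebra_simps)
    qed
    \<comment> \<open>\<open>R\<close> is the error in
      \<open>z' = \<kappa> / \<epsilon> * z + R * \<psi>\<close>: the deviation of \<open>Q\<close>
      from \<open>\<kappa>\<^sup>2\<close> and the variation of \<open>\<kappa>\<close>.\<close>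
    define R where "R = (Q x - k x) / \<epsilon> + \<kappa>' x"
    have eq: "2 * z x * z' x = 2 * \<kappa> x / \<epsilon> * (z x)\<^sup>2 + 2 * R * (\<psi> x * z x)"
      unfolding \<kappa>2[symmetric, of x] R_def z_def z'_def by (simp add: power2_eq_square diff_divide_distrib algebra_simps)
    \<comment> \<open>The constant \<open>7\<close> is \<open>2 * (3 + 1 / 2)\<close>:
      \<open>3 * \<eta>\<close> bounds \<open>\<bar>Q - k\<bar>\<close> and
      \<open>\<eta> / 2\<close> bounds \<open>\<epsilon> * \<bar>\<kappa>'\<bar>\<close>; dividing
      by \<open>\<kappa> \<ge> sqrt \<eta>\<close> leaves \<open>sqrt \<eta>\<close>.\<close>
    have R: "\<bar>2 * R\<bar> / \<kappa> x \<le> 7 * sqrt \<eta> / \<epsilon>"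
    proof -
      have "\<bar>Q x - k x\<bar> \<le> 3 * \<eta>" using Q[OF x] k(2,3)[of x] forb[OF x] eta by linarith
      then have "\<bar>(Q x - k x) / \<epsilon>\<bar> \<le> 3 * \<eta> / \<epsilon>"
        using eps by (simp add: divide_right_mono)
      moreover have "\<bar>\<kappa>' x\<bar> \<le> \<eta> / (2 * \<epsilon>)"
      proof -
        have "\<bar>\<kappa>' x\<bar> \<le> A / (2 * sqrt \<eta>)"
          using k'A[OF x] \<kappa>0[of x] \<kappa>\<eta>[of x] eta unfolding \<kappa>'_def abs_divide by (intro frac_le) auto
        also have "\<dots> \<le> (\<eta> * sqrt \<eta> / \<epsilon>) / (2 * sqrt \<eta>)"
          using A(2) eps eta by (intro divide_right_mono) (auto simp: le_divide_eq mult.commute)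
        also have "\<dots> = \<eta> / (2 * \<epsilon>)" using eta by simp
        finally show ?thesis .
      qed
      ultimately have "\<bar>R\<bar> \<le> 3 * \<eta> / \<epsilon> + \<eta> / (2 * \<epsilon>)"
        unfolding R_def by linarith
      also have "\<dots> = 7 * \<eta> / \<epsilon> / 2" by simp
      finally have "\<bar>2 * R\<bar> \<le> 7 * \<eta> / \<epsilon>" by simp
      then have "\<bar>2 * R\<bar> / \<kappa> x \<le> (7 * \<eta> / \<epsilon>) / sqrt \<eta>"
        using \<kappa>\<eta>[of x] eta eps by (intro frac_le) auto
      also have "\<dots> = 7 * (\<eta> / sqrt \<eta>) / \<epsilon>" by simp
      also have "\<eta> / sqrt \<eta> = sqrt \<eta>" using eta by (simp add: real_div_sqrt)
      finally show ?thesis .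
    qed
    have "\<bar>2 * R * (\<psi> x * z x)\<bar> \<le> \<bar>2 * R\<bar> * ((z x)\<^sup>2 / \<kappa> x)"
      unfolding abs_mult[of "2 * R"] using \<psi>z by (intro mult_left_mono) auto
    also have "\<dots> \<le> 7 * sqrt \<eta> / \<epsilon> * (z x)\<^sup>2"
      using mult_right_mono[OF R, of "(z x)\<^sup>2"] by simp
    finally have "2 * R * (\<psi> x * z x) \<ge> - (7 * sqrt \<eta> / \<epsilon> * (z x)\<^sup>2)" by linarith
    moreover have "2 * sqrt (max (t x) 0) / \<epsilon> * (z x)\<^sup>2 \<le> 2 * \<kappa> x / \<epsilon> * (z x)\<^sup>2"
    proof (intro mult_right_mono divide_right_mono)
      show "2 * sqrt (max (t x) 0) \<le> 2 * \<kappa> x"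
        using k(2)[of x] k0[of x] by (simp add: \<kappa>_def)
    qed (use eps in auto)
    ultimately show "(2 * sqrt (max (t x) 0) - 7 * sqrt \<eta>) / \<epsilon> * (z x)\<^sup>2 \<le> 2 * z x * z' x"
      unfolding eq diff_divide_distrib left_diff_distrib by linarith
  qed (use s G in auto)
  \<comment> \<open>By the parallelogram identity \<open>(p + \<kappa> * \<psi>)\<^sup>2 + (p -
    \<kappa> * \<psi>)\<^sup>2 = 2 * n\<close>; this is the origin of the factor
    \<open>1 / 2\<close> in the bound.\<close>
  moreover have "(z s)\<^sup>2 \<le> 2 * n s"
  proof -
    have "0 \<le> (p s - \<kappa> s * \<psi> s)\<^sup>2" by simp
    then show ?thesis
      unfolding n_def k_def[symmetric] \<kappa>2[symmetric] z_def
      by (simp add: power2_eq_square algebra_simps)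
  qed
  ultimately show ?thesis by (simp add: z_def init)
qed

text \<open>The energy satisfies \<open>\<bar>n'\<bar> \<le> G' * n\<close>, so a lower bound known
  at one point can be transported to any other, to the left or to the right, at the cost of the
  variation of \<open>G\<close>.\<close>

lemma energy_comparison:
  fixes \<psi> p t Q :: "real \<Rightarrow> real"
  assumes eps: "0 < \<epsilon>" and eta: "0 < \<eta>"
    and \<psi>: "\<And>x. x \<in> {0..L} \<Longrightarrow> (\<psi> has_real_derivative p x / \<epsilon>) (at x within {0..L})"
    and p: "\<And>x. x \<in> {0..L} \<Longrightarrow> (p has_real_derivative Q x * \<psi> x / \<epsilon>) (at x within {0..L})"
    and t: "\<And>x. x \<in> {0..L} \<Longrightarrow> (t has_real_derivative t' x) (at x within {0..L})"
    and A: "\<And>x. x \<in> {0..L} \<Longrightarrow> \<bar>t' x\<bar> \<le> A" "\<epsilon> * A \<le> \<eta> * sqrt \<eta>"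
    and Q: "\<And>x. x \<in> {0..L} \<Longrightarrow> \<bar>Q x - t x\<bar> \<le> 2 * \<eta>"
    and G: "\<And>x. x \<in> {0..L} \<Longrightarrow>
      (G has_real_derivative (2 * sqrt (max (t x) 0) + 5 * sqrt \<eta>) / \<epsilon>) (at x within {0..L})"
    and xy: "x \<in> {0..L}" "y \<in> {0..L}"
  defines "n \<equiv> \<lambda>x. (p x)\<^sup>2 + sqrt ((t x)\<^sup>2 + \<eta>\<^sup>2) * (\<psi> x)\<^sup>2"
  shows "n y * exp (- \<bar>G x - G y\<bar>) \<le> n x"
proof -
  have "\<exists>n'. (n has_real_derivative n') (at x within {0..L}) \<and>
      \<bar>n'\<bar> \<le> (2 * sqrt (max (t x) 0) + 5 * sqrt \<eta>) / \<epsilon> * n x" if "x \<in> {0..L}" for x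
    using energy_deriv_bound[where \<psi> = \<psi> and p = p and Q = Q and t = t, OF eps eta \<psi>[OF that] p[OF that] t[OF that] A(1)[OF that] A(2) Q[OF that]]
    unfolding n_def by blast
  then obtain n' where n': "\<And>x. x \<in> {0..L} \<Longrightarrow> (n has_real_derivative n' x) (at x within {0..L})"
    and bd: "\<And>x. x \<in> {0..L} \<Longrightarrow> \<bar>n' x\<bar> \<le> (2 * sqrt (max (t x) 0) + 5 * sqrt \<eta>) / \<epsilon> * n x"
    by metis
  have n0: "0 \<le> n x" for x
    unfolding n_def by simp
  show ?thesis
  proof (cases "y \<le> x")
    case True
    have sub: "z \<in> {0..L}" "{y..x} \<subseteq> {0..L}" if "z \<in> {y..x}" for z using that xy by auto
    have "n y * exp (- G x - (- G y)) \<le> n x"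
    proof (rule gronwall_exp[OF True])
      fix z assume z: "z \<in> {y..x}"
      note z = sub[OF z]
      show "(n has_real_derivative n' z) (at z within {y..x})"
        by (rule DERIV_subset[OF n'[OF z(1)] z(2)])
      show "((\<lambda>x. - G x) has_real_derivative - ((2 * sqrt (max (t z) 0) + 5 * sqrt \<eta>) / \<epsilon>)) (at z within {y..x})"
        by (rule DERIV_minus[OF DERIV_subset[OF G[OF z(1)] z(2)]])
      show "- ((2 * sqrt (max (t z) 0) + 5 * sqrt \<eta>) / \<epsilon>) * n z \<le> n' z"
        using bd[OF z(1)] by linarith
    qed
    moreover have "n y * exp (- \<bar>G x - G y\<bar>) \<le> n y * exp (- G x - (- G y))"
      using n0[of y] by (intro mult_left_mono) auto
    ultimately show ?thesis by simp
  next
    case False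
    then have xley: "x \<le> y" by simp
    have sub: "z \<in> {0..L}" "{x..y} \<subseteq> {0..L}" if "z \<in> {x..y}" for z using that xy by auto
    have "- n x * exp (G y - G x) \<le> - n y"
    proof (rule gronwall_exp[OF xley])
      fix z assume z: "z \<in> {x..y}"
      note z = sub[OF z]
      show "((\<lambda>x. - n x) has_real_derivative - n' z) (at z within {x..y})"
        by (rule DERIV_minus[OF DERIV_subset[OF n'[OF z(1)] z(2)]])
      show "(G has_real_derivative (2 * sqrt (max (t z) 0) + 5 * sqrt \<eta>) / \<epsilon>) (at z within {x..y})"
        by (rule DERIV_subset[OF G[OF z(1)] z(2)])
      show "(2 * sqrt (max (t z) 0) + 5 * sqrt \<eta>) / \<epsilon> * (- n z) \<le> - n' z"
        using bd[OF z(1)] by linarith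
    qed
    then have "n y * exp (- (G y - G x)) \<le> n x * exp (G y - G x) * exp (- (G y - G x))"
      by (intro mult_right_mono) auto
    also have "\<dots> = n x" by (simp add: mult.assoc flip: exp_add)
    finally have "n y * exp (- (G y - G x)) \<le> n x" .
    moreover have "n y * exp (- \<bar>G x - G y\<bar>) \<le> n y * exp (- (G y - G x))"
      using n0[of y] by (intro mult_left_mono) auto
    ultimately show ?thesis by simp
  qed
qed

text \<open>On the way from the Dirichlet point to the well the energy must grow, and beyond the
  well it can shrink only at the Agmon rate. Growth is proved only where
  \<open>t \<ge> 2 * \<eta>\<close>; on the remaining piece up to \<open>x0\<close> the Agmon rate
  is of order \<open>sqrt \<eta>\<close>, so crossing it by \<open>energy_comparison\<close> is
  cheap.\<close>

lemma agmon_energy_lower_bound: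
  fixes \<psi> p t Q :: "real \<Rightarrow> real"
  assumes eps: "0 < \<epsilon>" and eta: "0 < \<eta>"
    and \<psi>: "\<And>x. x \<in> {0..L} \<Longrightarrow> (\<psi> has_real_derivative p x / \<epsilon>) (at x within {0..L})"
    and p: "\<And>x. x \<in> {0..L} \<Longrightarrow> (p has_real_derivative Q x * \<psi> x / \<epsilon>) (at x within {0..L})"
    and t: "\<And>x. x \<in> {0..L} \<Longrightarrow> (t has_real_derivative t' x) (at x within {0..L})"
    and A: "\<And>x. x \<in> {0..L} \<Longrightarrow> \<bar>t' x\<bar> \<le> A" "\<epsilon> * A \<le> \<eta> * sqrt \<eta>"
    and Q: "\<And>x. x \<in> {0..L} \<Longrightarrow> \<bar>Q x - t x\<bar> \<le> 2 * \<eta>"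
    and init: "\<psi> 0 = 0" "p 0 = 1"
    and H: "\<And>x. x \<in> {0..L} \<Longrightarrow> (H has_real_derivative sqrt (max (t x) 0)) (at x within {0..L})"
    and x0: "x0 \<in> {0..L}" "t x0 \<le> 0"
    and decr: "\<And>x y. 0 \<le> x \<Longrightarrow> x \<le> y \<Longrightarrow> y \<le> x0 \<Longrightarrow> t y \<le> t x"
    and x: "x \<in> {0..L}"
  defines "n \<equiv> \<lambda>x. (p x)\<^sup>2 + sqrt ((t x)\<^sup>2 + \<eta>\<^sup>2) * (\<psi> x)\<^sup>2"
  shows "exp ((2 * (H x0 - H 0) - 2 * \<bar>H x - H x0\<bar> - 18 * sqrt \<eta> * L) / \<epsilon>) / 2 \<le> n x"
proof -
  define e where "e = sqrt \<eta>"
  have e: "0 < e" using eta by (simp add: e_def)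
  define G where "G x = (2 * H x + 5 * e * x) / \<epsilon>" for x
  define G2 where "G2 x = (2 * H x - 7 * e * x) / \<epsilon>" for x
  have G: "(G has_real_derivative (2 * sqrt (max (t x) 0) + 5 * sqrt \<eta>) / \<epsilon>) (at x within {0..L})"
    and G2: "(G2 has_real_derivative (2 * sqrt (max (t x) 0) - 7 * sqrt \<eta>) / \<epsilon>) (at x within {0..L})"
    if "x \<in> {0..L}" for x
    unfolding G_def G2_def e_def using eps
    by (auto intro!: derivative_eq_intros H that simp: field_simps)
  have comp: "n y * exp (- \<bar>G x - G y\<bar>) \<le> n x" if "x \<in> {0..L}" "y \<in> {0..L}" for x y
    unfolding n_def by (rule energy_comparison[OF eps eta \<psi> p t A Q G that])
  have n0: "0 \<le> n x" for x
    unfolding n_def by simp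
  \<comment> \<open>\<open>s\<close> is a point where \<open>t\<close> equals
    \<open>2 * \<eta>\<close>, or \<open>0\<close> when \<open>t 0\<close> is already below this
    level and there is no growth to exploit.\<close>
  obtain s where s: "s \<in> {0..x0}" "exp (G2 s - G2 0) / 2 \<le> n s" "\<And>x. x \<in> {s..x0} \<Longrightarrow> t x \<le> 2 * \<eta>"
  proof (cases "2 * \<eta> \<le> t 0")
    case False
    have "exp (G2 0 - G2 0) / 2 \<le> n 0" by (simp add: n_def init)
    moreover have "t x \<le> 2 * \<eta>" if "x \<in> {0..x0}" for x
      using decr[of 0 x] that False by auto
    ultimately show thesis using that[of 0] x0 by auto
  next
    case True
    have "continuous_on {0..L} t" using t by (rule DERIV_continuous_on)
    then have "continuous_on {0..x0} t" by (rule continuous_on_subset) (use x0 in auto)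
    then have "\<exists>s\<ge>0. s \<le> x0 \<and> t s = 2 * \<eta>"
      using True x0 eta by (intro IVT2') auto
    then obtain s where s: "0 \<le> s" "s \<le> x0" "t s = 2 * \<eta>" by blast
    have sub: "x \<in> {0..L}" "{0..s} \<subseteq> {0..L}" if "x \<in> {0..s}" for x using that s x0 by auto
    have "exp (G2 s - G2 0) / 2 \<le> n s"
      unfolding n_def
    proof (rule forbidden_region_growth[OF eps eta s(1), where Q = Q and t' = t' and A = A])
      fix x assume x: "x \<in> {0..s}"
      note x' = sub[OF x]
      show "(\<psi> has_real_derivative p x / \<epsilon>) (at x within {0..s})"
        "(p has_real_derivative Q x * \<psi> x / \<epsilon>) (at x within {0..s})"
        "(t has_real_derivative t' x) (at x within {0..s})"
        "(G2 has_real_derivative (2 * sqrt (max (t x) 0) - 7 * sqrt \<eta>) / \<epsilon>) (at x within {0..s})"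
        by (rule DERIV_subset[OF _ x'(2)] \<psi> p t G2 x')+
      show "2 * \<eta> \<le> t x" using decr[of x s] x s by auto
    qed (use sub A Q init in auto)
    moreover have "t x \<le> 2 * \<eta>" if "x \<in> {s..x0}" for x
      using decr[of s x] that s by auto
    ultimately show thesis using that[of s] s by auto
  qed
  have sL: "s \<in> {0..L}" "{s..x0} \<subseteq> {0..L}" using s x0 by auto
  have "2 * e * s - H s \<le> 2 * e * x0 - H x0"
  proof (rule has_real_derivative_nonneg_imp_le[where f = "\<lambda>x. 2 * e * x - H x"])
    fix x assume x: "x \<in> {s..x0}"
    then have xL: "x \<in> {0..L}" using sL by auto
    show "((\<lambda>x. 2 * e * x - H x) has_real_derivative 2 * e - sqrt (max (t x) 0)) (at x within {s..x0})"
      by (auto intro!: derivative_eq_intros DERIV_subset[OF H[OF xL] sL(2)])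
    have "sqrt (max (t x) 0) \<le> sqrt (4 * \<eta>)"
      using s(3)[OF x] eta by (intro real_sqrt_le_mono) auto
    then show "0 \<le> 2 * e - sqrt (max (t x) 0)" by (simp add: e_def real_sqrt_mult)
  qed (use s in simp)
  then have Hup: "H x0 - H s \<le> 2 * e * (x0 - s)" by (simp add: algebra_simps)
  have Hlo: "H s \<le> H x0"
  proof (rule has_real_derivative_nonneg_imp_le[where f = H])
    fix x assume x: "x \<in> {s..x0}"
    then have "x \<in> {0..L}" using sL by auto
    from DERIV_subset[OF H[OF this] sL(2)]
    show "(H has_real_derivative sqrt (max (t x) 0)) (at x within {s..x0})" .
  qed (use s in auto)
  have "exp ((2 * (H x0 - H 0) - 13 * e * L) / \<epsilon>) / 2 \<le> n x0"
  proof -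
    have "\<bar>G x0 - G s\<bar> = (2 * (H x0 - H s) + 5 * e * (x0 - s)) / \<epsilon>"
    proof -
      have "G x0 - G s = (2 * (H x0 - H s) + 5 * e * (x0 - s)) / \<epsilon>"
        by (simp add: G_def diff_divide_distrib[symmetric] algebra_simps)
      moreover have "0 \<le> 2 * (H x0 - H s) + 5 * e * (x0 - s)"
        using Hlo e s by auto
      ultimately show ?thesis using eps by simp
    qed
    moreover have "G2 s - G2 0 = (2 * (H s - H 0) - 7 * e * s) / \<epsilon>"
      by (simp add: G2_def diff_divide_distrib[symmetric] algebra_simps)
    \<comment> \<open>Replacing \<open>H s\<close> by \<open>H x0\<close> costs four times
      \<open>H x0 - H s \<le> 2 * e * (x0 - s)\<close>, and the comparison from \<open>s\<close> to
      \<open>x0\<close> costs \<open>5 * e * (x0 - s)\<close>: \<open>13 = 8 + 5\<close>, which also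
      covers the \<open>7\<close> on \<open>{0..s}\<close>. Moving on from \<open>x0\<close> to
      \<open>x\<close> adds another \<open>5\<close>, whence \<open>18\<close>.\<close>
    moreover have "2 * (H x0 - H 0) - 13 * e * L \<le>
       (2 * (H s - H 0) - 7 * e * s) - (2 * (H x0 - H s) + 5 * e * (x0 - s))"
    proof -
      have "e * s \<le> e * x0" "e * x0 \<le> e * L" using e s x0 by auto
      moreover have "0 \<le> e * s" using e s by auto
      ultimately show ?thesis using Hup unfolding right_diff_distrib by linarith
    qed
    ultimately have "(2 * (H x0 - H 0) - 13 * e * L) / \<epsilon> \<le> (G2 s - G2 0) + - \<bar>G x0 - G s\<bar>"
      using eps by (simp add: divide_right_mono flip: diff_divide_distrib)
    then have "exp ((2 * (H x0 - H 0) - 13 * e * L) / \<epsilon>) \<le> exp (G2 s - G2 0) * exp (- \<bar>G x0 - G s\<bar>)"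
      by (simp flip: exp_add)
    also have "\<dots> \<le> 2 * n s * exp (- \<bar>G x0 - G s\<bar>)"
      using s(2) by (intro mult_right_mono) auto
    also have "\<dots> \<le> 2 * n x0" using comp[OF x0(1) sL(1)] by simp
    finally show ?thesis by simp
  qed
  moreover have "exp (- (2 * \<bar>H x - H x0\<bar> + 5 * e * L) / \<epsilon>) \<le> exp (- \<bar>G x - G x0\<bar>)"
  proof -
    have "G x - G x0 = (2 * (H x - H x0) + 5 * e * (x - x0)) / \<epsilon>"
      by (simp add: G_def diff_divide_distrib[symmetric] algebra_simps)
    moreover have "\<bar>2 * (H x - H x0) + 5 * e * (x - x0)\<bar> \<le> 2 * \<bar>H x - H x0\<bar> + 5 * e * L"
    proof -
      have "\<bar>5 * e * (x - x0)\<bar> \<le> 5 * e * L"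
        unfolding abs_mult using e x x0(1) by (intro mult_mono) auto
      then show ?thesis
        by (rule order_trans[OF abs_triangle_ineq add_mono, rotated]) (simp only: abs_mult abs_numeral order_refl)
    qed
    ultimately have "\<bar>G x - G x0\<bar> \<le> (2 * \<bar>H x - H x0\<bar> + 5 * e * L) / \<epsilon>"
      using eps by (simp add: abs_divide divide_right_mono)
    then show ?thesis unfolding minus_divide_left[symmetric] by simp
  qed
  ultimately have "exp ((2 * (H x0 - H 0) - 13 * e * L) / \<epsilon>) / 2 * exp (- (2 * \<bar>H x - H x0\<bar> + 5 * e * L) / \<epsilon>)
      \<le> n x0 * exp (- \<bar>G x - G x0\<bar>)"
    using n0 by (intro mult_mono) auto
  also have "\<dots> \<le> n x" by (rule comp[OF x x0(1)])
  also have "exp ((2 * (H x0 - H 0) - 13 * e * L) / \<epsilon>) / 2 * exp (- (2 * \<bar>H x - H x0\<bar> + 5 * e * L) / \<epsilon>)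
     = exp ((2 * (H x0 - H 0) - 13 * e * L) / \<epsilon> + - (2 * \<bar>H x - H x0\<bar> + 5 * e * L) / \<epsilon>) / 2"
    unfolding exp_add by simp
  also have "(2 * (H x0 - H 0) - 13 * e * L) / \<epsilon> + - (2 * \<bar>H x - H x0\<bar> + 5 * e * L) / \<epsilon>
     = (2 * (H x0 - H 0) - 2 * \<bar>H x - H x0\<bar> - 18 * e * L) / \<epsilon>"
    unfolding add_divide_distrib[symmetric] by simp
  finally show ?thesis by (simp add: e_def)
qed

text \<open>Multiplying \<open>p * \<psi>\<close> by the cutoff \<open>((x - \<alpha>) * (\<beta> - x))\<^sup>2\<close> absorbs
  the derivative part \<open>p\<^sup>2\<close> of the energy. The constant \<open>1 / 30\<close> is the integral of the cutoff
  over an interval of length \<open>1\<close>.\<close>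

lemma caccioppoli:
  fixes \<psi> p Q k :: "real \<Rightarrow> real"
  assumes eps: "0 < \<epsilon>" "\<epsilon> \<le> 1" and ab: "\<alpha> \<le> \<beta>"
    and \<psi>: "\<And>x. x \<in> {\<alpha>..\<beta>} \<Longrightarrow> (\<psi> has_real_derivative p x / \<epsilon>) (at x within {\<alpha>..\<beta>})"
    and p: "\<And>x. x \<in> {\<alpha>..\<beta>} \<Longrightarrow> (p has_real_derivative Q x * \<psi> x / \<epsilon>) (at x within {\<alpha>..\<beta>})"
    and J: "\<And>x. x \<in> {\<alpha>..\<beta>} \<Longrightarrow> (J has_real_derivative (\<psi> x)\<^sup>2) (at x within {\<alpha>..\<beta>})"
    and M: "\<And>x. x \<in> {\<alpha>..\<beta>} \<Longrightarrow> \<bar>Q x\<bar> \<le> M" "\<And>x. x \<in> {\<alpha>..\<beta>} \<Longrightarrow> \<bar>k x\<bar> \<le> M"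
    and m: "\<And>x. x \<in> {\<alpha>..\<beta>} \<Longrightarrow> m \<le> (p x)\<^sup>2 + k x * (\<psi> x)\<^sup>2"
  shows "m * ((\<beta> - \<alpha>) ^ 5 / 30) \<le> (4 * (\<beta> - \<alpha>)\<^sup>2 + 3 * M * (\<beta> - \<alpha>) ^ 4) * (J \<beta> - J \<alpha>)"
proof -
  define l where "l = \<beta> - \<alpha>"
  define B where "B = 4 * l\<^sup>2 + 3 * M * l ^ 4"
  define \<theta> where "\<theta> x = (x - \<alpha>) * (\<beta> - x)" for x
  define P where "P x = l\<^sup>2 * (x - \<alpha>) ^ 3 / 3 - l * (x - \<alpha>) ^ 4 / 2 + (x - \<alpha>) ^ 5 / 5" for x
  \<comment> \<open>\<open>P\<close> is the primitive of the squared cutoff that vanishes at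
    \<open>\<alpha>\<close>. The middle term of \<open>\<Phi>\<close> vanishes at both ends together
    with the cutoff, so the claim is the inequality
    \<open>\<Phi> \<alpha> \<le> \<Phi> \<beta>\<close>.\<close>
  define \<Phi> where "\<Phi> x = B * J x + 2 * \<epsilon> * ((\<theta> x)\<^sup>2 * (p x * \<psi> x)) - m * P x" for x
  have \<theta>': "(\<theta> has_real_derivative (\<beta> - x) - (x - \<alpha>)) (at x within S)" for x S
    unfolding \<theta>_def by (auto intro!: derivative_eq_intros)
  have P': "(P has_real_derivative (\<theta> x)\<^sup>2) (at x within S)" for x S
  proof -
    define y where "y = x - \<alpha>"
    have "(P has_real_derivative l\<^sup>2 * y\<^sup>2 - 2 * l * y ^ 3 + y ^ 4) (at x within S)"
      unfolding P_def y_def by (auto intro!: derivative_eq_intros)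
    moreover have "\<theta> x = y * (l - y)" by (simp add: \<theta>_def y_def l_def)
    moreover have "(y * (l - y))\<^sup>2 = l\<^sup>2 * y\<^sup>2 - 2 * l * y ^ 3 + y ^ 4"
      by (simp add: power2_eq_square power3_eq_cube power4_eq_xxxx algebra_simps)
    ultimately show ?thesis by simp
  qed
  have "\<Phi> \<alpha> \<le> \<Phi> \<beta>"
  proof (rule has_real_derivative_nonneg_imp_le[OF ab])
    fix x assume x: "x \<in> {\<alpha>..\<beta>}"
    define \<theta>1 where "\<theta>1 = (\<beta> - x) - (x - \<alpha>)"
    define \<Phi>' where "\<Phi>' = B * (\<psi> x)\<^sup>2 + (4 * \<epsilon> * \<theta> x * \<theta>1 * p x * \<psi> x
       + 2 * (\<theta> x)\<^sup>2 * ((p x)\<^sup>2 + Q x * (\<psi> x)\<^sup>2)) - m * (\<theta> x)\<^sup>2"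
    show "(\<Phi> has_real_derivative \<Phi>') (at x within {\<alpha>..\<beta>})"
      unfolding \<Phi>_def \<Phi>'_def \<theta>1_def
      by (rule derivative_eq_intros J \<theta>' P' \<psi> p x refl)+
        (use eps in \<open>simp add: field_simps power2_eq_square\<close>)
    have \<theta>b: "(\<theta> x)\<^sup>2 \<le> l ^ 4"
    proof -
      have "\<theta> x \<le> l * l" unfolding \<theta>_def l_def using x by (intro mult_mono) auto
      then have "(\<theta> x)\<^sup>2 \<le> (l * l)\<^sup>2"
        using x by (intro power_mono) (auto simp: \<theta>_def)
      then show ?thesis by (simp add: power2_eq_square power4_eq_xxxx)
    qed
    have \<theta>1b: "\<epsilon>\<^sup>2 * \<theta>1\<^sup>2 \<le> l\<^sup>2"
    proof -
      have "\<theta>1\<^sup>2 \<le> l\<^sup>2" using x by (intro power2_le_iff_abs_le[THEN iffD2]) (auto simp: \<theta>1_def l_def)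
      moreover have "\<epsilon>\<^sup>2 \<le> 1" using eps by (simp add: power_le_one)
      ultimately have "\<epsilon>\<^sup>2 * \<theta>1\<^sup>2 \<le> 1 * l\<^sup>2" by (intro mult_mono) auto
      then show ?thesis by simp
    qed
    have "(\<theta> x)\<^sup>2 * (k x - 2 * Q x) \<le> l ^ 4 * (3 * M)"
    proof -
      have "k x - 2 * Q x \<le> 3 * M" "0 \<le> 3 * M" using M[OF x] by linarith+
      then have "(\<theta> x)\<^sup>2 * (k x - 2 * Q x) \<le> (\<theta> x)\<^sup>2 * (3 * M)" "(\<theta> x)\<^sup>2 * (3 * M) \<le> l ^ 4 * (3 * M)"
        using \<theta>b by (auto intro: mult_left_mono mult_right_mono)
      then show ?thesis by linarith
    qed
    \<comment> \<open>Completing the square splits \<open>\<Phi>'\<close> into the three nonnegative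
      terms listed from here on. \<open>B\<close> is chosen to dominate the coefficients of
      \<open>\<psi>\<^sup>2\<close> left over: \<open>4 * l\<^sup>2\<close> for the slope of the
      cutoff, where \<open>\<epsilon> \<le> 1\<close> enters, and \<open>3 * M * l ^ 4\<close> for
      \<open>k - 2 * Q\<close>.\<close>
    then have "0 \<le> (B - 4 * (\<epsilon>\<^sup>2 * \<theta>1\<^sup>2) - (\<theta> x)\<^sup>2 * (k x - 2 * Q x)) * (\<psi> x)\<^sup>2"
      using \<theta>1b by (intro mult_nonneg_nonneg) (auto simp: B_def mult.commute)
    moreover have "0 \<le> (\<theta> x * p x + 2 * \<epsilon> * \<theta>1 * \<psi> x)\<^sup>2" by simp
    moreover have "0 \<le> (\<theta> x)\<^sup>2 * ((p x)\<^sup>2 + k x * (\<psi> x)\<^sup>2 - m)" using m[OF x] by simp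
    ultimately show "0 \<le> \<Phi>'"
      unfolding \<Phi>'_def power2_eq_square by (simp add: algebra_simps)
  qed
  moreover have "P \<beta> = l ^ 5 / 30"
    unfolding P_def l_def[symmetric] by (simp add: power_numeral_reduce field_simps)
  moreover have "P \<alpha> = 0" "\<theta> \<alpha> = 0" "\<theta> \<beta> = 0" by (simp_all add: P_def \<theta>_def)
  ultimately have "m * (l ^ 5 / 30) \<le> B * (J \<beta> - J \<alpha>)"
    by (simp add: \<Phi>_def algebra_simps)
  then show ?thesis by (simp add: B_def l_def)
qed

section \<open>Eigenfunctions and the cost of null control\<close>

text \<open>The definitions integrate over open intervals with respect to Lebesgue measure, while
  the fundamental theorem of calculus is used for the gauge integral on closed intervals; this is
  the passage between them.\<close>

lemma
  fixes f :: "real \<Rightarrow> real"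
  assumes "continuous_on {a..b} f"
  shows integrable_lebesgue_on_open_interval: "integrable (lebesgue_on {a<..<b}) f"
    and integral_lebesgue_on_open_interval: "integral\<^sup>L (lebesgue_on {a<..<b}) f = integral {a..b} f"
proof -
  have "set_integrable lebesgue {a..b} f"
    by (rule absolutely_integrable_continuous_real[OF assms])
  then have "set_integrable lebesgue {a<..<b} f"
    by (rule set_integrable_subset) auto
  then show int: "integrable (lebesgue_on {a<..<b}) f"
    by (simp add: integrable_restrict_space set_integrable_def)
  show "integral\<^sup>L (lebesgue_on {a<..<b}) f = integral {a..b} f"
    using lebesgue_integral_eq_integral[OF int] by (simp add: integral_open_interval_real)
qed

text \<open>The transposition identity pairs the boundary slope at time \<open>t\<close> with the
  control at time \<open>T - t\<close>; the reflection removes this reversal of time.\<close>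

lemma
  fixes f :: "real \<Rightarrow> real"
  assumes "integrable (lebesgue_on {0<..<T}) f"
  shows integrable_lebesgue_on_reflect: "integrable (lebesgue_on {0<..<T}) (\<lambda>t. f (T - t))"
    and integral_lebesgue_on_reflect:
      "integral\<^sup>L (lebesgue_on {0<..<T}) (\<lambda>t. f (T - t)) = integral\<^sup>L (lebesgue_on {0<..<T}) f"
proof -
  define g where "g x = indicator {0<..<T} x *\<^sub>R f x" for x
  have "integrable lebesgue g"
    using assms by (simp add: integrable_restrict_space g_def[abs_def])
  then have "has_bochner_integral lebesgue g (integral\<^sup>L lebesgue g)"
    by (rule has_bochner_integral_integrable)
  then have "has_bochner_integral lebesgue (\<lambda>x. g (T + (-1) * x)) (integral\<^sup>L lebesgue g)"
    by (subst (asm) has_bochner_integral_lebesgue_real_affine_iff[of "-1" _ _ T]) auto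
  moreover have "(\<lambda>x. g (T + (-1) * x)) = (\<lambda>t. indicator {0<..<T} t *\<^sub>R f (T - t))"
    by (auto simp: g_def indicator_def)
  ultimately have *: "has_bochner_integral lebesgue (\<lambda>t. indicator {0<..<T} t *\<^sub>R f (T - t)) (integral\<^sup>L lebesgue g)"
    by simp
  then show "integrable (lebesgue_on {0<..<T}) (\<lambda>t. f (T - t))"
    by (simp add: integrable_restrict_space has_bochner_integral_iff)
  show "integral\<^sup>L (lebesgue_on {0<..<T}) (\<lambda>t. f (T - t)) = integral\<^sup>L (lebesgue_on {0<..<T}) f"
    using * by (simp add: integral_restrict_space has_bochner_integral_iff g_def[abs_def])
qed

section \<open>Square-integrable functions and membership in \<open>H10\<close>\<close>

lemma continuous_in_L2: "continuous_on {0..L} f \<Longrightarrow> f \<in> L2 {0<..<L}"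
  using integrable_lebesgue_on_open_interval[of 0 L f]
    integrable_lebesgue_on_open_interval[of 0 L "\<lambda>x. (f x)\<^sup>2"]
  by (auto simp: L2_def intro!: continuous_intros)

lemma
  assumes h: "h \<in> L2 {0<..<T}" and "0 < T"
  shows L2_imp_integrable: "integrable (lebesgue_on {0<..<T}) h"
    and L1_le_L2_norm: "integral\<^sup>L (lebesgue_on {0<..<T}) (\<lambda>t. \<bar>h t\<bar>) \<le> sqrt T * L2_norm {0<..<T} h"
proof -
  let ?M = "lebesgue_on {0<..<T}"
  interpret finite_measure ?M
    by (rule finite_measure_lebesgue_on) simp
  have h2: "integrable ?M (\<lambda>t. (h t)\<^sup>2)" and hm: "h \<in> borel_measurable ?M"
    using h by (auto simp: L2_def)
  show hi: "integrable ?M h"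
  proof (rule Bochner_Integration.integrable_bound)
    show "integrable ?M (\<lambda>t. 1 + (h t)\<^sup>2)" using h2 by auto
    show "AE t in ?M. norm (h t) \<le> norm (1 + (h t)\<^sup>2)"
    proof (rule AE_I2)
      fix t
      have "0 \<le> (\<bar>h t\<bar> - 1/2)\<^sup>2" by simp
      then show "norm (h t) \<le> norm (1 + (h t)\<^sup>2)"
        by (simp add: power2_diff power_divide)
    qed
  qed fact
  define X where "X = integral\<^sup>L ?M (\<lambda>t. \<bar>h t\<bar>)"
  define S where "S = integral\<^sup>L ?M (\<lambda>t. (h t)\<^sup>2)"
  have vol: "measure ?M (space ?M) = T"
    using assms(2) by (simp add: measure_restrict_space)
  \<comment> \<open>Cauchy-Schwarz as nonnegativity of a variance: \<open>X / T\<close> is the mean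
    of \<open>\<bar>h\<bar>\<close>.\<close>
  have "0 \<le> integral\<^sup>L ?M (\<lambda>t. (\<bar>h t\<bar> - X / T)\<^sup>2)" by simp
  also have "\<dots> = integral\<^sup>L ?M (\<lambda>t. (h t)\<^sup>2 - 2 * (X / T) * \<bar>h t\<bar> + (X / T)\<^sup>2)"
    by (simp add: power2_diff algebra_simps)
  also have "\<dots> = S - 2 * (X / T) * X + (X / T)\<^sup>2 * T"
    using hi h2 vol by (simp add: X_def S_def)
  also have "\<dots> = S - X\<^sup>2 / T"
    using assms(2) by (simp add: field_simps power2_eq_square)
  finally have "X\<^sup>2 \<le> T * S"
    using assms(2) by (simp add: field_simps)
  then have "X \<le> sqrt (T * S)" by (rule real_le_rsqrt)
  then show "X \<le> sqrt T * L2_norm {0<..<T} h"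
    by (simp add: real_sqrt_mult L2_norm_def S_def)
qed

lemma smooth_in_H10:
  assumes L: "0 < L"
    and \<phi>: "\<And>x. x \<in> {0..L} \<Longrightarrow> (\<phi> has_real_derivative \<phi>' x) (at x within {0..L})"
    and \<phi>': "continuous_on {0..L} \<phi>'"
    and "\<phi> 0 = 0" "\<phi> L = 0"
  shows "\<phi> \<in> H10 L"
proof -
  have cont: "continuous_on {0..L} \<phi>" using \<phi> by (rule DERIV_continuous_on)
  have "weak_deriv L \<phi> \<phi>'"
    unfolding weak_deriv_def
  proof (intro allI impI, elim conjE exE)
    fix \<omega> \<omega>' :: "real \<Rightarrow> real" and c d
    assume \<omega>: "\<forall>x. (\<omega> has_real_derivative \<omega>' x) (at x)" and \<omega>': "continuous_on UNIV \<omega>'"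
      and cd: "0 < c" "d < L" "\<forall>x. x \<notin> {c..d} \<longrightarrow> \<omega> x = 0"
    have "continuous_on {0..L} \<omega>"
      by (rule DERIV_continuous_on, rule has_field_derivative_at_within, rule \<omega>[rule_format])
    moreover have "continuous_on {0..L} \<omega>'"
      using \<omega>' by (rule continuous_on_subset) simp
    ultimately have contc: "continuous_on {0..L} \<omega>" "continuous_on {0..L} \<omega>'" .
    have "\<omega> 0 = 0" "\<omega> L = 0" using cd by auto
    have "((\<lambda>x. \<phi> x * \<omega>' x + \<phi>' x * \<omega> x) has_integral \<phi> L * \<omega> L - \<phi> 0 * \<omega> 0) {0..L}"
    proof (rule fundamental_theorem_of_calculus)
      fix x assume x: "x \<in> {0..L}"
      have "((\<lambda>x. \<phi> x * \<omega> x) has_real_derivative \<phi>' x * \<omega> x + \<omega>' x * \<phi> x) (at x within {0..L})"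
        by (rule DERIV_mult \<phi> x has_field_derivative_at_within[OF \<omega>[rule_format]])+
      then show "((\<lambda>x. \<phi> x * \<omega> x) has_vector_derivative \<phi> x * \<omega>' x + \<phi>' x * \<omega> x) (at x within {0..L})"
        by (simp add: has_real_derivative_iff_has_vector_derivative[symmetric] algebra_simps)
    qed (use L in simp)
    then have "integral {0..L} (\<lambda>x. \<phi> x * \<omega>' x + \<phi>' x * \<omega> x) = 0"
      using assms(4,5) by (simp add: integral_unique)
    moreover have "integral {0..L} (\<lambda>x. \<phi> x * \<omega>' x + \<phi>' x * \<omega> x)
        = integral {0..L} (\<lambda>x. \<phi> x * \<omega>' x) + integral {0..L} (\<lambda>x. \<phi>' x * \<omega> x)"
      by (intro integral_add integrable_continuous_real continuous_intros cont contc \<phi>')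
    ultimately show "L2_inner {0<..<L} \<phi> \<omega>' = - L2_inner {0<..<L} \<phi>' \<omega>"
      unfolding L2_inner_def
      by (subst (1 2) integral_lebesgue_on_open_interval) (auto intro!: continuous_intros cont contc \<phi>')
  qed
  then show ?thesis
    unfolding H10_def using continuous_in_L2[OF cont] continuous_in_L2[OF \<phi>'] cont assms(4,5) by auto
qed

section \<open>Separated solutions of the adjoint equation and duality\<close>

lemma eigenfunction_adjoint_solution:
  assumes \<phi>: "\<And>x. x \<in> {0..L} \<Longrightarrow> (\<phi> has_real_derivative \<phi>' x) (at x within {0..L})"
    and \<phi>': "\<And>x. x \<in> {0..L} \<Longrightarrow> (\<phi>' has_real_derivative \<phi>'' x) (at x within {0..L})"
    and \<phi>'': "continuous_on {0..L} \<phi>''"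
    and eq: "\<And>x. x \<in> {0..L} \<Longrightarrow> a x * \<phi>' x + (a' x - b x) * \<phi> x + \<epsilon> * \<phi>'' x = - \<mu> * \<phi> x"
    and bc: "\<phi> 0 = 0" "\<phi> L = 0"
  shows "adjoint_solution L a a' b T \<epsilon> \<phi> (\<lambda>t x. exp (- \<mu> * t) * \<phi> x) (\<lambda>t x. exp (- \<mu> * t) * \<phi>' x)"
proof -
  have cont: "continuous_on {0..L} \<phi>" "continuous_on {0..L} \<phi>'"
    using \<phi> \<phi>' by (blast intro: DERIV_continuous_on)+
  have ct: "continuous_on (I \<times> {0..L}) (\<lambda>(t, x). c * exp (- \<mu> * t) * f x)"
    if "continuous_on {0..L} f" for I c and f :: "real \<Rightarrow> real"
    unfolding case_prod_unfold
    by (intro continuous_intros continuous_on_compose2[OF that]) auto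
  have "((\<lambda>s. exp (- \<mu> * s) * \<phi> x) has_real_derivative - \<mu> * exp (- \<mu> * t) * \<phi> x) (at t within {0..T}) \<and>
      ((\<lambda>x. exp (- \<mu> * t) * \<phi> x) has_real_derivative exp (- \<mu> * t) * \<phi>' x) (at x within {0..L}) \<and>
      ((\<lambda>x. exp (- \<mu> * t) * \<phi>' x) has_real_derivative exp (- \<mu> * t) * \<phi>'' x) (at x within {0..L}) \<and>
      - \<mu> * exp (- \<mu> * t) * \<phi> x - a x * (exp (- \<mu> * t) * \<phi>' x) - (a' x - b x) * (exp (- \<mu> * t) * \<phi> x)
        - \<epsilon> * (exp (- \<mu> * t) * \<phi>'' x) = 0" if tx: "t \<in> {0<..T}" "x \<in> {0..L}" for t x
  proof (intro conjI)
    show "((\<lambda>s. exp (- \<mu> * s) * \<phi> x) has_real_derivative - \<mu> * exp (- \<mu> * t) * \<phi> x) (at t within {0..T})"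
      by (auto intro!: derivative_eq_intros)
    show "((\<lambda>x. exp (- \<mu> * t) * \<phi> x) has_real_derivative exp (- \<mu> * t) * \<phi>' x) (at x within {0..L})"
      "((\<lambda>x. exp (- \<mu> * t) * \<phi>' x) has_real_derivative exp (- \<mu> * t) * \<phi>'' x) (at x within {0..L})"
      by (rule DERIV_cmult \<phi> \<phi>' tx)+
    have "- \<mu> * exp (- \<mu> * t) * \<phi> x - a x * (exp (- \<mu> * t) * \<phi>' x) - (a' x - b x) * (exp (- \<mu> * t) * \<phi> x)
        - \<epsilon> * (exp (- \<mu> * t) * \<phi>'' x)
      = exp (- \<mu> * t) * (- \<mu> * \<phi> x - (a x * \<phi>' x + (a' x - b x) * \<phi> x + \<epsilon> * \<phi>'' x))"
      by (simp add: algebra_simps)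
    also have "\<dots> = 0" unfolding eq[OF tx(2)] by simp
    finally show "- \<mu> * exp (- \<mu> * t) * \<phi> x - a x * (exp (- \<mu> * t) * \<phi>' x) - (a' x - b x) * (exp (- \<mu> * t) * \<phi> x)
        - \<epsilon> * (exp (- \<mu> * t) * \<phi>'' x) = 0" .
  qed
  then show ?thesis
    unfolding adjoint_solution_def
    using ct[OF cont(1), of "{0..T}" 1] ct[OF cont(1), of "{0<..T}" "- \<mu>"] ct[OF cont(2), of "{0<..T}" 1]
      ct[OF \<phi>'', of "{0<..T}" 1] bc
    by (intro conjI, simp, simp, simp)
      (rule exI[where x = "\<lambda>t x. - \<mu> * exp (- \<mu> * t) * \<phi> x"],
        rule exI[where x = "\<lambda>t x. exp (- \<mu> * t) * \<phi>'' x"], simp)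
qed

text \<open>Duality: testing the control system against \<open>exp (- \<mu> * t) * \<phi> x\<close>, with the normalized
  \<open>\<phi>\<close> as initial state, bounds every null control from below.\<close>

lemma control_cost_ge_eigenfunction:
  assumes L: "0 < L" and T: "0 < T" and eps: "0 < \<epsilon>"
    and \<phi>: "\<And>x. x \<in> {0..L} \<Longrightarrow> (\<phi> has_real_derivative \<phi>' x) (at x within {0..L})"
    and \<phi>': "\<And>x. x \<in> {0..L} \<Longrightarrow> (\<phi>' has_real_derivative \<phi>'' x) (at x within {0..L})"
    and \<phi>'': "continuous_on {0..L} \<phi>''"
    and eq: "\<And>x. x \<in> {0..L} \<Longrightarrow> a x * \<phi>' x + (a' x - b x) * \<phi> x + \<epsilon> * \<phi>'' x = - \<mu> * \<phi> x"
    and bc: "\<phi> 0 = 0" "\<phi> L = 0"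
    and pos: "0 < L2_norm {0<..<L} \<phi>" and slope: "\<phi>' 0 \<noteq> 0"
    and \<mu>: "- \<mu> \<le> \<Lambda>" "0 \<le> \<Lambda>"
  shows "ereal (exp (- \<mu> * T) * L2_norm {0<..<L} \<phi> / (\<epsilon> * \<bar>\<phi>' 0\<bar> * exp (\<Lambda> * T) * sqrt T))
    \<le> control_cost L a a' b T \<epsilon>"
proof -
  define N where "N = L2_norm {0<..<L} \<phi>"
  have N: "0 < N" using pos by (simp add: N_def)
  have cont: "continuous_on {0..L} \<phi>" "continuous_on {0..L} \<phi>'"
    using \<phi> \<phi>' by (blast intro: DERIV_continuous_on)+
  define y0 where "y0 x = \<phi> x / N" for x
  have y0L2: "y0 \<in> L2 {0<..<L}"
    unfolding y0_def[abs_def] using cont N by (intro continuous_in_L2 continuous_intros) auto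
  have N2: "integral\<^sup>L (lebesgue_on {0<..<L}) (\<lambda>x. (\<phi> x)\<^sup>2) = N\<^sup>2"
    unfolding N_def L2_norm_def by simp
  have "L2_norm {0<..<L} y0 = 1"
    using N by (simp add: L2_norm_def y0_def power_divide N2)
  let ?c = "exp (- \<mu> * T) * N / (\<epsilon> * \<bar>\<phi>' 0\<bar> * exp (\<Lambda> * T) * sqrt T)"
  have "ereal ?c \<le> ereal (L2_norm {0<..<T} h)" if "h \<in> null_controls L a a' b T \<epsilon> y0" for h
  proof -
    let ?MT = "lebesgue_on {0<..<T}"
    from that obtain y where h: "h \<in> L2 {0<..<T}" and y: "transposition_solution L a a' b T \<epsilon> y0 h y"
      and yT: "AE x in lebesgue_on {0<..<L}. y T x = 0"
      by (auto simp: null_controls_def)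
    have "L2_inner {0<..<L} (\<lambda>x. exp (- \<mu> * T) * \<phi> x) y0 - L2_inner {0<..<L} \<phi> (y T)
      + integral\<^sup>L ?MT (\<lambda>t. \<epsilon> * (exp (- \<mu> * t) * \<phi>' 0) * h (T - t)) = 0"
      using y T smooth_in_H10[OF L \<phi> cont(2) bc]
        eigenfunction_adjoint_solution[where a = a and a' = a' and b = b and \<epsilon> = \<epsilon> and \<mu> = \<mu> and T = T,
          OF \<phi> \<phi>' \<phi>'' eq bc]
      unfolding transposition_solution_def by fastforce
    moreover have "L2_inner {0<..<L} \<phi> (y T) = 0"
      unfolding L2_inner_def by (rule integral_eq_zero_AE) (use yT in auto)
    moreover have "L2_inner {0<..<L} (\<lambda>x. exp (- \<mu> * T) * \<phi> x) y0 = exp (- \<mu> * T) * N"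
    proof -
      have "L2_inner {0<..<L} (\<lambda>x. exp (- \<mu> * T) * \<phi> x) y0
        = integral\<^sup>L (lebesgue_on {0<..<L}) (\<lambda>x. exp (- \<mu> * T) / N * (\<phi> x)\<^sup>2)"
        unfolding L2_inner_def y0_def by (simp add: power2_eq_square algebra_simps)
      also have "\<dots> = exp (- \<mu> * T) / N * N\<^sup>2" unfolding N2[symmetric] by simp
      finally show ?thesis using N by (simp add: power2_eq_square)
    qed
    moreover have "0 \<le> exp (- \<mu> * T) * N" using N by simp
    ultimately have "exp (- \<mu> * T) * N = \<bar>integral\<^sup>L ?MT (\<lambda>t. \<epsilon> * (exp (- \<mu> * t) * \<phi>' 0) * h (T - t))\<bar>"
      by linarith
    also have "\<dots> \<le> integral\<^sup>L ?MT (\<lambda>t. \<epsilon> * \<bar>\<phi>' 0\<bar> * exp (\<Lambda> * T) * \<bar>h (T - t)\<bar>)"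
    proof (rule order_trans[OF integral_abs_bound], rule integral_mono_AE')
      show "integrable ?MT (\<lambda>t. \<epsilon> * \<bar>\<phi>' 0\<bar> * exp (\<Lambda> * T) * \<bar>h (T - t)\<bar>)"
        using integrable_lebesgue_on_reflect[OF L2_imp_integrable[OF h T]] by auto
      show "AE t in ?MT. \<bar>\<epsilon> * (exp (- \<mu> * t) * \<phi>' 0) * h (T - t)\<bar> \<le> \<epsilon> * \<bar>\<phi>' 0\<bar> * exp (\<Lambda> * T) * \<bar>h (T - t)\<bar>"
      proof (rule AE_I2)
        fix t assume "t \<in> space ?MT"
        then have t: "0 < t" "t < T" by auto
        \<comment> \<open>\<open>\<Lambda>\<close> allows for a negative \<open>\<mu>\<close>, for
          which \<open>exp (- \<mu> * t)\<close> grows; the bound by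
          \<open>exp (\<Lambda> * T)\<close> is uniform in time.\<close>
        have "- \<mu> * t \<le> \<Lambda> * t" using \<mu>(1) t by (intro mult_right_mono) auto
        also have "\<dots> \<le> \<Lambda> * T" using \<mu>(2) t by (intro mult_left_mono) auto
        finally have "exp (- \<mu> * t) \<le> exp (\<Lambda> * T)" by simp
        then have "(\<epsilon> * \<bar>\<phi>' 0\<bar> * \<bar>h (T - t)\<bar>) * exp (- \<mu> * t) \<le> (\<epsilon> * \<bar>\<phi>' 0\<bar> * \<bar>h (T - t)\<bar>) * exp (\<Lambda> * T)"
          using eps by (intro mult_left_mono) auto
        then show "\<bar>\<epsilon> * (exp (- \<mu> * t) * \<phi>' 0) * h (T - t)\<bar> \<le> \<epsilon> * \<bar>\<phi>' 0\<bar> * exp (\<Lambda> * T) * \<bar>h (T - t)\<bar>"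
          using eps by (simp add: abs_mult algebra_simps)
      qed
    qed (use eps in auto)
    also have "\<dots> = \<epsilon> * \<bar>\<phi>' 0\<bar> * exp (\<Lambda> * T) * integral\<^sup>L ?MT (\<lambda>t. \<bar>h t\<bar>)"
      using integral_lebesgue_on_reflect[of T "\<lambda>t. \<bar>h t\<bar>"] L2_imp_integrable[OF h T] by simp
    also have "\<dots> \<le> \<epsilon> * \<bar>\<phi>' 0\<bar> * exp (\<Lambda> * T) * (sqrt T * L2_norm {0<..<T} h)"
      using L1_le_L2_norm[OF h T] eps by (intro mult_left_mono) auto
    finally show ?thesis
      using eps T slope by (simp add: divide_le_eq mult.commute mult.left_commute)
  qed
  \<comment> \<open>If \<open>y0\<close> admits no null control, the infimum is
    \<open>\<infinity>\<close> and the bound still holds.\<close>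
  then have "ereal ?c \<le> (INF h \<in> null_controls L a a' b T \<epsilon> y0. ereal (L2_norm {0<..<T} h))"
    by (rule INF_greatest)
  then show ?thesis
    unfolding control_cost_def N_def
    by (intro SUP_upper2[where i = y0]) (use y0L2 \<open>L2_norm {0<..<L} y0 = 1\<close> in auto)
qed

text \<open>The conjugation \<open>\<phi> = exp (- f / (2 * \<epsilon>)) * \<psi>\<close> turns the Schroedinger equation with potential
  \<open>a\<^sup>2 / 4 + \<epsilon> * (b - a' / 2)\<close> into the eigenvalue equation of the adjoint operator.\<close>

lemma control_cost_ge_schroedinger:
  assumes L: "0 < L" and T: "0 < T" and eps: "0 < \<epsilon>"
    and a: "\<And>x. x \<in> {0..L} \<Longrightarrow> (a has_real_derivative a' x) (at x within {0..L})"
    and a': "continuous_on {0..L} a'" and b: "continuous_on {0..L} b"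
    and f: "\<And>x. x \<in> {0..L} \<Longrightarrow> (f has_real_derivative a x) (at x within {0..L})" "f 0 = 0"
    and \<psi>: "\<And>x. x \<in> {0..L} \<Longrightarrow> (\<psi> has_real_derivative p x / \<epsilon>) (at x within {0..L})"
    and p: "\<And>x. x \<in> {0..L} \<Longrightarrow> (p has_real_derivative
      (potential a x + \<epsilon> * (b x - a' x / 2) - \<mu>) * \<psi> x / \<epsilon>) (at x within {0..L})"
    and bc: "\<psi> 0 = 0" "p 0 = 1" "\<psi> L = 0"
    and \<eta>: "- \<mu> \<le> \<eta>" "0 \<le> \<eta>"
    and I: "0 < I" "I \<le> integral {0..L} (\<lambda>x. exp (- f x / \<epsilon>) * (\<psi> x)\<^sup>2)"
  shows "ereal (exp (- (\<mu> + \<eta>) * T / \<epsilon>) * sqrt I / sqrt T) \<le> control_cost L a a' b T \<epsilon>"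
proof -
  define g where "g x = exp (- f x / (2 * \<epsilon>))" for x
  define q where "q x = potential a x + \<epsilon> * (b x - a' x / 2) - \<mu>" for x
  define \<phi> where "\<phi> x = g x * \<psi> x" for x
  define \<phi>' where "\<phi>' x = g x * (p x - a x * \<psi> x / 2) / \<epsilon>" for x
  define \<phi>'' where "\<phi>'' x = (- (a x * g x / (2 * \<epsilon>)) * (p x - a x * \<psi> x / 2)
     + g x * (q x * \<psi> x / \<epsilon> - (a' x * \<psi> x + a x * p x / \<epsilon>) / 2)) / \<epsilon>" for x
  have g: "(g has_real_derivative - (a x * g x / (2 * \<epsilon>))) (at x within {0..L})" if "x \<in> {0..L}" for x
  proof -
    have "((\<lambda>x. - f x / (2 * \<epsilon>)) has_real_derivative - a x / (2 * \<epsilon>)) (at x within {0..L})"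
      by (rule DERIV_cdivide DERIV_minus f(1) that)+
    from DERIV_chain2[OF DERIV_exp this] show ?thesis by (simp add: g_def[abs_def] mult.commute)
  qed
  have \<phi>: "(\<phi> has_real_derivative \<phi>' x) (at x within {0..L})" if "x \<in> {0..L}" for x
    using DERIV_mult[OF g[OF that] \<psi>[OF that]]
    unfolding \<phi>_def \<phi>'_def by (simp add: diff_divide_distrib algebra_simps)
  have \<phi>': "(\<phi>' has_real_derivative \<phi>'' x) (at x within {0..L})" if x: "x \<in> {0..L}" for x
  proof -
    have "((\<lambda>x. p x - a x * \<psi> x / 2) has_real_derivative
        q x * \<psi> x / \<epsilon> - (a' x * \<psi> x + p x / \<epsilon> * a x) / 2) (at x within {0..L})"
      by (rule DERIV_diff DERIV_cdivide DERIV_mult p[OF x, folded q_def] a[OF x] \<psi>[OF x])+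
    from DERIV_cdivide[OF DERIV_mult[OF g[OF x] this], of \<epsilon>]
    show ?thesis
      unfolding \<phi>'_def \<phi>''_def by (simp add: mult.commute)
  qed
  have cont_a: "continuous_on {0..L} a" using a by (rule DERIV_continuous_on)
  have cont_\<psi>: "continuous_on {0..L} \<psi>" using \<psi> by (rule DERIV_continuous_on)
  have cont_p: "continuous_on {0..L} p" using p by (rule DERIV_continuous_on)
  have cont_g: "continuous_on {0..L} g" using g by (rule DERIV_continuous_on)
  note cont = cont_a cont_\<psi> cont_p cont_g
  have \<phi>'': "continuous_on {0..L} \<phi>''"
    unfolding \<phi>''_def q_def potential_def using eps by (intro continuous_intros cont a' b) auto
  \<comment> \<open>The conjugated operator is \<open>1 / \<epsilon>\<close> times the semiclassical
    one, so an energy \<open>\<mu>\<close> becomes the time rate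
    \<open>\<mu> / \<epsilon>\<close>.\<close>
  have eq: "a x * \<phi>' x + (a' x - b x) * \<phi> x + \<epsilon> * \<phi>'' x = - (\<mu> / \<epsilon>) * \<phi> x" for x
  proof -
    have q: "q x / \<epsilon> = a x * a x / (4 * \<epsilon>) + (b x - a' x / 2) - \<mu> / \<epsilon>"
      unfolding q_def potential_def using eps by (simp add: add_divide_distrib diff_divide_distrib power2_eq_square)
    have "\<epsilon> * \<phi>'' x = - (a x * g x / (2 * \<epsilon>)) * (p x - a x * \<psi> x / 2)
       + g x * (q x / \<epsilon> * \<psi> x - (a' x * \<psi> x + a x * p x / \<epsilon>) / 2)"
      unfolding \<phi>''_def using eps by simp
    then show ?thesis
      unfolding q \<phi>_def \<phi>'_def by (simp add: add_divide_distrib diff_divide_distrib algebra_simps)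
  qed
  have norm: "sqrt I \<le> L2_norm {0<..<L} \<phi>"
  proof -
    have "exp (- f x / \<epsilon>) = (g x)\<^sup>2" for x
    proof -
      have "- f x / \<epsilon> = 2 * (- f x / (2 * \<epsilon>))" by simp
      then show ?thesis unfolding g_def by (simp only: exp_double)
    qed
    moreover have "integral\<^sup>L (lebesgue_on {0<..<L}) (\<lambda>x. (\<phi> x)\<^sup>2) = integral {0..L} (\<lambda>x. (g x)\<^sup>2 * (\<psi> x)\<^sup>2)"
      unfolding \<phi>_def power_mult_distrib
      by (intro integral_lebesgue_on_open_interval continuous_intros cont)
    ultimately show ?thesis using I(2) by (simp add: L2_norm_def)
  qed
  have slope: "\<phi>' 0 = 1 / \<epsilon>" by (simp add: \<phi>'_def g_def f bc)
  \<comment> \<open>The additional \<open>\<eta>\<close> in the exponent comes from the choice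
    \<open>\<Lambda> = \<eta> / \<epsilon>\<close>, which covers energies slightly below
    \<open>0\<close>.\<close>
  have ratio: "exp (- (\<mu> + \<eta>) * T / \<epsilon>) = exp (- (\<mu> / \<epsilon>) * T) / exp (\<eta> / \<epsilon> * T)"
  proof -
    have "- (\<mu> + \<eta>) * T / \<epsilon> = - (\<mu> / \<epsilon>) * T - \<eta> / \<epsilon> * T"
      by (simp add: add_divide_distrib diff_divide_distrib algebra_simps)
    then show ?thesis by (simp only: exp_diff)
  qed
  have "exp (- (\<mu> + \<eta>) * T / \<epsilon>) * sqrt I / sqrt T \<le> exp (- (\<mu> + \<eta>) * T / \<epsilon>) * L2_norm {0<..<L} \<phi> / sqrt T"
    using norm T by (intro divide_right_mono mult_left_mono) auto
  also have "\<dots> = exp (- (\<mu> / \<epsilon>) * T) * L2_norm {0<..<L} \<phi> / (\<epsilon> * \<bar>\<phi>' 0\<bar> * exp (\<eta> / \<epsilon> * T) * sqrt T)"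
    unfolding ratio using eps by (simp add: slope)
  finally show ?thesis
  proof (rule order_trans[OF ereal_less_eq(3)[THEN iffD2]])
    show "ereal (exp (- (\<mu> / \<epsilon>) * T) * L2_norm {0<..<L} \<phi> / (\<epsilon> * \<bar>\<phi>' 0\<bar> * exp (\<eta> / \<epsilon> * T) * sqrt T))
      \<le> control_cost L a a' b T \<epsilon>"
    proof (rule control_cost_ge_eigenfunction[OF L T eps \<phi> \<phi>' \<phi>'' eq])
      show "\<phi> 0 = 0" "\<phi> L = 0" by (simp_all add: \<phi>_def bc)
      have "0 < sqrt I" using I(1) by simp
      then show "0 < L2_norm {0<..<L} \<phi>" using norm by linarith
      show "\<phi>' 0 \<noteq> 0" using slope eps by simp
      show "- (\<mu> / \<epsilon>) \<le> \<eta> / \<epsilon>" using \<eta> eps divide_right_mono[of "- \<mu>" \<eta> \<epsilon>] by simp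
      show "0 \<le> \<eta> / \<epsilon>" using \<eta> eps by simp
    qed
  qed
qed

section \<open>The Agmon distance of a single well\<close>

lemma interior_max_critical:
  fixes V :: "real \<Rightarrow> real"
  assumes "x < y" "y < z" "V x < V y" "V z < V y"
    and diff: "\<And>w. w \<in> {x..z} \<Longrightarrow> (V has_real_derivative V' w) (at w within {x..z})"
  obtains w where "w \<in> {x<..<z}" "V' w = 0"
proof -
  have "continuous_on {x..z} V" using diff by (rule DERIV_continuous_on)
  then obtain w where w: "w \<in> {x..z}" "\<And>v. v \<in> {x..z} \<Longrightarrow> V v \<le> V w"
    using continuous_attains_sup[of "{x..z}" V] assms(1,2) by auto
  have "V y \<le> V w" using w(2)[of y] assms(1,2) by auto
  then have "w \<noteq> x" "w \<noteq> z" using assms(3,4) by auto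
  with w(1) have w': "w \<in> {x<..<z}" by auto
  then have "(V has_real_derivative V' w) (at w)"
    using diff[OF w(1)] at_within_Icc_at[of x w z] by simp
  moreover have "\<forall>v. \<bar>w - v\<bar> < min (w - x) (z - w) \<longrightarrow> V v \<le> V w"
    using w(2) by (auto simp: abs_if split: if_splits)
  ultimately have "V' w = 0"
    using DERIV_local_max[of V "V' w" w "min (w - x) (z - w)"] w' by auto
  with w' show thesis by (rule that)
qed

text \<open>If \<open>V\<close> increased somewhere to the left of \<open>x0\<close>, it would have
  to descend again to its minimum at \<open>x0\<close>, and the maximum in between would be a second
  critical point; the right side is symmetric.\<close>

lemma
  fixes V :: "real \<Rightarrow> real"
  assumes diff: "\<And>x. x \<in> {0..L} \<Longrightarrow> (V has_real_derivative V' x) (at x within {0..L})"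
    and crit: "\<And>x. x \<in> {0..L} \<Longrightarrow> V' x = 0 \<Longrightarrow> x = x0"
    and x0: "x0 \<in> {0..L}" and min: "\<And>x. x \<in> {0..L} \<Longrightarrow> V x0 \<le> V x"
  shows antimono_left_of_critical_min: "0 \<le> x \<Longrightarrow> x \<le> y \<Longrightarrow> y \<le> x0 \<Longrightarrow> V y \<le> V x"
    and mono_right_of_critical_min: "x0 \<le> x \<Longrightarrow> x \<le> y \<Longrightarrow> y \<le> L \<Longrightarrow> V x \<le> V y"
proof -
  show "V y \<le> V x" if xy: "0 \<le> x" "x \<le> y" "y \<le> x0"
  proof (rule ccontr)
    assume neg: "\<not> V y \<le> V x"
    have "V x0 \<le> V x" using min[of x] xy x0 by simp
    with neg have "x < y" "y < x0" "V x < V y" "V x0 < V y"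
      using xy by (auto simp: less_le)
    moreover have "(V has_real_derivative V' w) (at w within {x..x0})" if "w \<in> {x..x0}" for w
      using that xy x0 by (intro DERIV_subset[OF diff]) auto
    ultimately obtain w where "w \<in> {x<..<x0}" "V' w = 0"
      by (rule interior_max_critical)
    then show False using crit[of w] xy x0 by auto
  qed
  show "V x \<le> V y" if xy: "x0 \<le> x" "x \<le> y" "y \<le> L"
  proof (rule ccontr)
    assume neg: "\<not> V x \<le> V y"
    have "V x0 \<le> V y" using min[of y] xy x0 by simp
    with neg have "x0 < x" "x < y" "V x0 < V x" "V y < V x"
      using xy by (auto simp: less_le)
    moreover have "(V has_real_derivative V' w) (at w within {x0..y})" if "w \<in> {x0..y}" for w
      using that xy x0 by (intro DERIV_subset[OF diff]) auto
    ultimately obtain w where "w \<in> {x0<..<y}" "V' w = 0"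
      by (rule interior_max_critical)
    then show False using crit[of w] xy x0 by auto
  qed
qed

lemma interval_integral_antiderivative:
  fixes f F :: "real \<Rightarrow> real"
  assumes "continuous_on {0..L} f"
    and F: "\<And>x. x \<in> {0..L} \<Longrightarrow> (F has_real_derivative f x) (at x within {0..L})"
    and "x \<in> {0..L}" "y \<in> {0..L}"
  shows "(LBINT s=y..x. f s) = F x - F y"
proof (rule interval_integral_FTC_finite)
  have sub: "{min y x..max y x} \<subseteq> {0..L}" using assms(3,4) by auto
  show "continuous_on {min y x..max y x} f"
    by (rule continuous_on_subset[OF assms(1) sub])
  show "(F has_vector_derivative f z) (at z within {min y x..max y x})"
    if "min y x \<le> z" "z \<le> max y x" for z
  proof -
    have z: "z \<in> {0..L}" using that sub by (intro subsetD[OF sub]) simp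
    show ?thesis
      using DERIV_subset[OF F[OF z] sub] by (simp add: has_real_derivative_iff_has_vector_derivative)
  qed
qed

text \<open>By the monotonicity on both sides, every \<open>y\<close> with
  \<open>V y \<le> E\<close> is joined to \<open>x0\<close> inside the sublevel set. The integrand
  vanishes there, so \<open>H y = H x0\<close>, and the infimum runs over a single value.\<close>

lemma agmon_dist_eq:
  fixes V H :: "real \<Rightarrow> real"
  assumes V: "continuous_on {0..L} V"
    and left: "\<And>x y. 0 \<le> x \<Longrightarrow> x \<le> y \<Longrightarrow> y \<le> x0 \<Longrightarrow> V y \<le> V x"
    and right: "\<And>x y. x0 \<le> x \<Longrightarrow> x \<le> y \<Longrightarrow> y \<le> L \<Longrightarrow> V x \<le> V y"
    and x0: "x0 \<in> {0..L}" "V x0 \<le> E"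
    and H: "\<And>x. x \<in> {0..L} \<Longrightarrow> (H has_real_derivative sqrt (max (V x - E) 0)) (at x within {0..L})"
    and x: "x \<in> {0..L}"
  shows "agmon_dist L V E x = \<bar>H x - H x0\<bar>"
proof -
  have const: "H u = H v" if uv: "u \<le> v" "u \<in> {0..L}" "v \<in> {0..L}" and low: "\<And>z. z \<in> {u..v} \<Longrightarrow> V z \<le> E" for u v
  proof (rule antisym)
    have d: "(H has_real_derivative 0) (at z within {u..v})" if "z \<in> {u..v}" for z
      using DERIV_subset[OF H, of z "{u..v}"] low[OF that] uv that by (auto simp: max_absorb2)
    show "H u \<le> H v"
      by (rule has_real_derivative_nonneg_imp_le[OF uv(1) d]) auto
    have "- H u \<le> - H v"
      by (rule has_real_derivative_nonneg_imp_le[where f = "\<lambda>x. - H x", OF uv(1) DERIV_minus[OF d]]) auto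
    then show "H v \<le> H u" by simp
  qed
  have "\<bar>LBINT s=y..x. sqrt (max (V s - E) 0)\<bar> = \<bar>H x - H x0\<bar>" if y: "y \<in> {0..L}" "V y \<le> E" for y
  proof -
    have "H y = H x0"
    proof (cases "y \<le> x0")
      case True
      show ?thesis
      proof (rule const[OF True y(1) x0(1)])
        show "V z \<le> E" if "z \<in> {y..x0}" for z using left[of y z] that y by auto
      qed
    next
      case False
      then have "x0 \<le> y" by simp
      have "H x0 = H y"
      proof (rule const[OF \<open>x0 \<le> y\<close> x0(1) y(1)])
        show "V z \<le> E" if "z \<in> {x0..y}" for z using right[of z y] that y by auto
      qed
      then show ?thesis ..
    qed
    moreover have "(LBINT s=y..x. sqrt (max (V s - E) 0)) = H x - H y"
      by (rule interval_integral_antiderivative[OF _ H x y(1)]) (auto intro!: continuous_intros V)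
    ultimately show ?thesis by simp
  qed
  then have "(\<lambda>y. \<bar>LBINT s=y..x. sqrt (max (V s - E) 0)\<bar>) ` {y \<in> {0..L}. V y \<le> E} = {\<bar>H x - H x0\<bar>}"
    using x0 by force
  then show ?thesis unfolding agmon_dist_def by simp
qed

section \<open>The lower bounds\<close>

lemma eventually_mult_le_at_right_0:
  fixes c d :: real
  assumes "0 < d"
  shows "\<forall>\<^sub>F \<epsilon> in at_right 0. \<epsilon> * c \<le> d"
proof -
  have "((\<lambda>\<epsilon>. \<epsilon> * c) \<longlongrightarrow> 0) (at_right 0)"
    by (auto intro!: tendsto_eq_intros)
  from order_tendstoD(2)[OF this assms] show ?thesis
    by eventually_elim simp
qed

text \<open>The point may be an endpoint of \<open>{0..L}\<close>; truncating a neighbourhood at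
  \<open>0\<close> and \<open>L\<close> still leaves an interval of positive length.\<close>

lemma eventually_within_interval:
  fixes L :: real
  assumes "0 < L" "x \<in> {0..L}" "P x" and ev: "\<forall>\<^sub>F y in at x within {0..L}. P y"
  obtains \<alpha> \<beta> where "0 \<le> \<alpha>" "\<alpha> < \<beta>" "\<beta> \<le> L" "\<And>y. y \<in> {\<alpha>..\<beta>} \<Longrightarrow> P y"
proof -
  from ev obtain d where d: "0 < d" "\<And>y. y \<in> {0..L} \<Longrightarrow> y \<noteq> x \<Longrightarrow> dist y x < d \<Longrightarrow> P y"
    unfolding eventually_at by blast
  show thesis
  proof (rule that[of "max 0 (x - d/2)" "min L (x + d/2)"])
    fix y assume y: "y \<in> {max 0 (x - d/2)..min L (x + d/2)}"
    then have "y \<in> {0..L}" "dist y x < d" using d(1) by (auto simp: dist_real_def)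
    then show "P y" using d(2)[of y] assms(3) by (cases "y = x") auto
  qed (use assms(1,2) d(1) in auto)
qed

lemma eventually_abs_diff_le:
  fixes g :: "real \<Rightarrow> real"
  assumes "continuous_on S g" "x \<in> S" "0 < r"
  shows "\<forall>\<^sub>F y in at x within S. \<bar>g y - g x\<bar> \<le> r"
proof -
  have "(g \<longlongrightarrow> g x) (at x within S)"
    using assms(1,2) by (simp add: continuous_on)
  from tendstoD[OF this assms(3)] show ?thesis
    by eventually_elim (simp add: dist_real_def)
qed

lemma potential_deriv:
  assumes "(a has_real_derivative d) (at x within S)"
  shows "(potential a has_real_derivative a x * d / 2) (at x within S)"
  using DERIV_cdivide[OF DERIV_mult[OF assms assms], of 4]
  by (simp add: potential_def[abs_def] power2_eq_square mult.commute)

text \<open>Of the margin \<open>\<delta>\<close>, \<open>5 / 16\<close> is spent on the norm of the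
  eigenfunction and \<open>1 / 8\<close> on replacing \<open>\<mu> + \<eta>\<close> by
  \<open>E\<close>; the remaining \<open>9 / 16\<close> outweighs the constant \<open>c2\<close>,
  which does not depend on \<open>\<epsilon>\<close>.\<close>

lemma control_cost_exponential_lower_bound:
  fixes L T x0 E \<delta> :: real and a a' b :: "real \<Rightarrow> real"
  assumes L: "0 < L" and T: "0 < T"
    and a: "\<And>x. x \<in> {0..L} \<Longrightarrow> (a has_real_derivative a' x) (at x within {0..L})"
    and a': "continuous_on {0..L} a'" and b: "continuous_on {0..L} b"
    and x0: "x0 \<in> {0..L}"
    and crit: "\<And>x. x \<in> {0..L} \<Longrightarrow> a x * a' x / 2 = 0 \<Longrightarrow> x = x0"
    and vmin: "\<And>x. x \<in> {0..L} \<Longrightarrow> potential a x0 \<le> potential a x"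
    and E: "E \<in> potential a ` {0..L}" and \<delta>: "0 < \<delta>"
  shows "\<forall>\<^sub>F \<epsilon> in at_right 0.
    ereal (exp (1 / \<epsilon> * (W_gap L a E - E * T - \<delta>))) \<le> control_cost L a a' b T \<epsilon>"
proof -
  define V where "V = potential a"
  define V' where "V' x = a x * a' x / 2" for x
  have V: "(V has_real_derivative V' x) (at x within {0..L})" if "x \<in> {0..L}" for x
    unfolding V_def V'_def by (rule potential_deriv[OF a[OF that]])
  have cont_a: "continuous_on {0..L} a" using a by (rule DERIV_continuous_on)
  have cont_V: "continuous_on {0..L} V" using V by (rule DERIV_continuous_on)
  have cont_V': "continuous_on {0..L} V'"
    unfolding V'_def by (intro continuous_intros cont_a a') auto
  have E0: "0 \<le> E" using E by (auto simp: potential_def)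
  have Vx0: "V x0 \<le> E" using E vmin by (auto simp: V_def)
  have left: "V y \<le> V x" if "0 \<le> x" "x \<le> y" "y \<le> x0" for x y
    using antimono_left_of_critical_min[OF V _ x0 _ that] crit vmin by (simp add: V_def V'_def)
  have right: "V x \<le> V y" if "x0 \<le> x" "x \<le> y" "y \<le> L" for x y
    using mono_right_of_critical_min[OF V _ x0 _ that] crit vmin by (simp add: V_def V'_def)

  define f where "f x = integral {0..x} a" for x
  define \<rho> where "\<rho> x = sqrt (max (V x - E) 0)" for x
  define H where "H x = integral {0..x} \<rho>" for x
  have cont_\<rho>: "continuous_on {0..L} \<rho>"
    unfolding \<rho>_def by (intro continuous_intros cont_V)
  have f: "(f has_real_derivative a x) (at x within {0..L})" if "x \<in> {0..L}" for x
    unfolding f_def by (rule integral_has_real_derivative[OF cont_a that])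
  have H: "(H has_real_derivative sqrt (max (V x - E) 0)) (at x within {0..L})" if "x \<in> {0..L}" for x
    unfolding H_def using integral_has_real_derivative[OF cont_\<rho> that] by (simp add: \<rho>_def)
  have f0: "f 0 = 0" and H0: "H 0 = 0" by (simp_all add: f_def H_def)
  have Hx0: "0 \<le> H x0"
    unfolding H_def \<rho>_def by (rule integral_nonneg) (use integrable_continuous_real[OF continuous_on_subset[OF cont_\<rho>]] x0 in \<open>auto simp: \<rho>_def[abs_def]\<close>)
  have cont_f: "continuous_on {0..L} f" using f by (rule DERIV_continuous_on)
  have cont_H: "continuous_on {0..L} H" using H by (rule DERIV_continuous_on)

  have W: "W L a E x = f x / 2 + \<bar>H x - H x0\<bar>" if x: "x \<in> {0..L}" for x
    using agmon_dist_eq[OF cont_V left right x0 Vx0 H x] interval_integral_antiderivative[OF cont_a f x, of 0] L f0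
    by (simp add: W_def V_def zero_ereal_def)
  have "continuous_on {0..L} (W L a E)"
    by (subst continuous_on_cong[OF refl W]) (auto intro!: continuous_intros cont_f cont_H)
  then obtain xs where xs: "xs \<in> {0..L}" "\<And>x. x \<in> {0..L} \<Longrightarrow> W L a E xs \<le> W L a E x"
    using continuous_attains_inf[of "{0..L}" "W L a E"] L by auto
  have "(INF x\<in>{0..L}. W L a E x) = W L a E xs"
    by (rule cInf_eq_minimum) (use xs in auto)
  then have gap: "W_gap L a E = H x0 - \<bar>H xs - H x0\<bar> - f xs / 2"
    using W[OF xs(1)] W[of 0] L f0 H0 Hx0 by (simp add: W_gap_def)

  \<comment> \<open>The bound \<open>1\<close> is required by \<open>dirichlet_eigenpair\<close>,
    the square makes \<open>18 * sqrt \<eta> * L \<le> \<delta> / 4\<close>, and the last entry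
    makes \<open>2 * \<eta> * T \<le> \<delta> / 8\<close>.\<close>
  define \<eta> where "\<eta> = min 1 (min ((\<delta> / (72 * L))\<^sup>2) (\<delta> / (16 * T)))"
  have \<eta>: "0 < \<eta>" "\<eta> \<le> 1" and "\<eta> \<le> \<delta> / (16 * T)"
    using \<delta> L T by (auto simp: \<eta>_def)
  then have \<eta>T: "2 * \<eta> * T \<le> \<delta> / 8"
    using T by (simp add: le_divide_eq algebra_simps)
  have \<eta>L: "18 * sqrt \<eta> * L \<le> \<delta> / 4"
  proof -
    have "sqrt \<eta> \<le> \<delta> / (72 * L)"
      using \<delta> L by (intro real_le_lsqrt) (auto simp: \<eta>_def)
    then show ?thesis using L by (simp add: field_simps)
  qed

  \<comment> \<open>Two unrelated intervals are fixed. \<open>{\<alpha>..\<beta>}\<close>, near the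
    minimizer \<open>xs\<close> of \<open>W_E\<close>, is where the mass of the eigenfunction is
    measured; \<open>{\<alpha>'..\<beta>'}\<close>, near a point with \<open>V = E\<close>, is where
    the Pruefer angles separate.\<close>
  define P where "P x \<longleftrightarrow> \<bar>f x - f xs\<bar> \<le> \<delta> / 8 \<and> \<bar>H x - H xs\<bar> \<le> \<delta> / 8" for x
  have "P xs" using \<delta> by (simp add: P_def)
  moreover have "\<forall>\<^sub>F x in at xs within {0..L}. P x"
    unfolding P_def
    by (intro eventually_conj eventually_abs_diff_le cont_f cont_H xs(1)) (use \<delta> in auto)
  ultimately obtain \<alpha> \<beta> where ab: "0 \<le> \<alpha>" "\<alpha> < \<beta>" "\<beta> \<le> L"
    and near: "\<And>x. x \<in> {\<alpha>..\<beta>} \<Longrightarrow> \<bar>f x - f xs\<bar> \<le> \<delta> / 8 \<and> \<bar>H x - H xs\<bar> \<le> \<delta> / 8"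
    using eventually_within_interval[OF L xs(1), of P] unfolding P_def by blast
  from E obtain xE where xE: "xE \<in> {0..L}" "V xE = E" by (auto simp: V_def)
  \<comment> \<open>The tolerance \<open>\<eta> / 4\<close> leaves another \<open>\<eta> / 4\<close>
    for the lower order term \<open>\<epsilon> * q\<close>; \<open>dirichlet_eigenpair\<close>
    admits \<open>\<eta> / 2\<close>.\<close>
  define P' where "P' x \<longleftrightarrow> \<bar>V x - E\<bar> \<le> \<eta> / 4" for x
  have "P' xE" using \<eta> xE by (simp add: P'_def)
  moreover have "\<forall>\<^sub>F x in at xE within {0..L}. P' x"
    unfolding P'_def xE(2)[symmetric] by (intro eventually_abs_diff_le cont_V xE(1)) (use \<eta> in auto)
  ultimately obtain \<alpha>' \<beta>' where ab': "0 \<le> \<alpha>'" "\<alpha>' < \<beta>'" "\<beta>' \<le> L"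
    and near': "\<And>x. x \<in> {\<alpha>'..\<beta>'} \<Longrightarrow> \<bar>V x - E\<bar> \<le> \<eta> / 4"
    using eventually_within_interval[OF L xE(1), of P'] unfolding P'_def by blast
  define q where "q x = b x - a' x / 2" for x
  have cont_q: "continuous_on {0..L} q" unfolding q_def by (intro continuous_intros a' b) auto
  obtain q0 where q0: "\<And>x. x \<in> {0..L} \<Longrightarrow> \<bar>q x\<bar> \<le> q0"
    using continuous_on_interval_bound[OF cont_q] by blast
  obtain MV where MV: "\<And>x. x \<in> {0..L} \<Longrightarrow> \<bar>V x\<bar> \<le> MV"
    using continuous_on_interval_bound[OF cont_V] by blast
  obtain A where A: "\<And>x. x \<in> {0..L} \<Longrightarrow> \<bar>V' x\<bar> \<le> A"
    using continuous_on_interval_bound[OF cont_V'] by blast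

  define l where "l = \<beta> - \<alpha>"
  define M where "M = MV + \<bar>E\<bar> + 2"
  define B where "B = 4 * l\<^sup>2 + 3 * M * l ^ 4"
  \<comment> \<open>\<open>1 / 60\<close> is \<open>1 / 30\<close> from \<open>caccioppoli\<close>
    times the factor \<open>1 / 2\<close> of the energy bound.\<close>
  define c1 where "c1 = l ^ 5 / 60 / B"
  define c2 where "c2 = sqrt c1 / sqrt T"
  have l: "0 < l" using ab by (simp add: l_def)
  have "0 \<le> MV" using MV[of 0] L by force
  then have "0 < B" using l by (simp add: B_def M_def add_pos_nonneg)
  then have c1: "0 < c1" using l by (simp add: c1_def)
  then have c2: "0 < c2" using T by (simp add: c2_def)
  define gp where "gp = W_gap L a E"

  have "\<forall>\<^sub>F \<epsilon> :: real in at_right 0. 0 < \<epsilon>" by (rule eventually_at_right_less)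
  moreover have "\<forall>\<^sub>F \<epsilon> in at_right 0. \<epsilon> * 1 \<le> (1::real)"
    "\<forall>\<^sub>F \<epsilon> in at_right 0. \<epsilon> * q0 \<le> \<eta> / 4"
    "\<forall>\<^sub>F \<epsilon> in at_right 0. \<epsilon> * (3 * pi) \<le> \<eta> / 2 * (\<beta>' - \<alpha>')"
    "\<forall>\<^sub>F \<epsilon> in at_right 0. \<epsilon> * A \<le> \<eta> * sqrt \<eta>"
    "\<forall>\<^sub>F \<epsilon> in at_right 0. \<epsilon> * 1 \<le> c2 * (9 / 16 * \<delta>)"
    by (rule eventually_mult_le_at_right_0; use \<eta> ab' c2 \<delta> in simp)+
  ultimately show ?thesis
    unfolding gp_def[symmetric]
  proof eventually_elim
    case (elim \<epsilon>)
    note eps = elim(1)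
    define Q where "Q x = potential a x + \<epsilon> * (b x - a' x / 2)" for x
    have Q: "Q x = V x + \<epsilon> * q x" for x by (simp add: Q_def V_def q_def)
    have \<epsilon>q: "\<bar>\<epsilon> * q x\<bar> \<le> \<eta> / 4" if "x \<in> {0..L}" for x
    proof -
      have "\<epsilon> * \<bar>q x\<bar> \<le> \<epsilon> * q0" using q0[OF that] eps by (intro mult_left_mono) auto
      also have "\<dots> \<le> \<eta> / 4" by (rule elim(3))
      finally show ?thesis using eps by (simp add: abs_mult)
    qed
    have cont_Q: "continuous_on {0..L} Q"
      unfolding Q by (intro continuous_intros cont_V cont_q)
    have Q_near: "\<bar>Q x - E\<bar> \<le> \<eta> / 2" if "x \<in> {\<alpha>'..\<beta>'}" for x
    proof -
      have "x \<in> {0..L}" using that ab' by auto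
      from near'[OF that] \<epsilon>q[OF this] show ?thesis unfolding Q by linarith
    qed
    have long: "3 * pi * \<epsilon> \<le> \<eta> / 2 * (\<beta>' - \<alpha>')" using elim(4) by (simp add: mult.commute)
    obtain \<mu> \<psi> p where \<mu>: "\<bar>\<mu> - E\<bar> \<le> \<eta>" and bc: "\<psi> 0 = 0" "p 0 = 1" "\<psi> L = 0"
      and \<psi>: "\<And>x. x \<in> {0..L} \<Longrightarrow> (\<psi> has_real_derivative p x / \<epsilon>) (at x within {0..L})"
      and p: "\<And>x. x \<in> {0..L} \<Longrightarrow> (p has_real_derivative (Q x - \<mu>) * \<psi> x / \<epsilon>) (at x within {0..L})"
      using dirichlet_eigenpair[OF eps ab' cont_Q Q_near \<eta> long] by blast
    have cont_\<psi>: "continuous_on {0..L} \<psi>" using \<psi> by (rule DERIV_continuous_on)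
    have t: "((\<lambda>x. V x - E) has_real_derivative V' x) (at x within {0..L})" if "x \<in> {0..L}" for x
      using V[OF that] by (auto intro!: derivative_eq_intros)
    have Qt: "\<bar>(Q x - \<mu>) - (V x - E)\<bar> \<le> 2 * \<eta>" if "x \<in> {0..L}" for x
      using \<epsilon>q[OF that] \<mu> unfolding Q by linarith
    define k where "k x = sqrt ((V x - E)\<^sup>2 + \<eta>\<^sup>2)" for x
    define m where "m = exp ((2 * H x0 - 2 * \<bar>H xs - H x0\<bar> - \<delta> / 2) / \<epsilon>) / 2"
    have energy: "m \<le> (p x)\<^sup>2 + k x * (\<psi> x)\<^sup>2" if x: "x \<in> {\<alpha>..\<beta>}" for x
    proof -
      have xL: "x \<in> {0..L}" using x ab by auto
      have Vx0': "V x0 - E \<le> 0" using Vx0 by simp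
      have left': "V y - E \<le> V x - E" if "0 \<le> x" "x \<le> y" "y \<le> x0" for x y
        using left[OF that] by simp
      \<comment> \<open>The loss \<open>\<delta> / 2\<close> consists of
        \<open>2 * \<delta> / 8\<close> for passing from \<open>xs\<close> to \<open>x\<close> and
        \<open>\<delta> / 4\<close> for the term with \<open>sqrt \<eta>\<close>.\<close>
      have "2 * H x0 - 2 * \<bar>H xs - H x0\<bar> - \<delta> / 2
          \<le> 2 * (H x0 - H 0) - 2 * \<bar>H x - H x0\<bar> - 18 * sqrt \<eta> * L"
      proof -
        have "\<bar>H x - H x0\<bar> \<le> \<bar>H xs - H x0\<bar> + \<delta> / 8"
          using conjunct2[OF near[OF x]] by linarith
        then show ?thesis using \<eta>L unfolding H0 by argo
      qed
      then have "m \<le> exp ((2 * (H x0 - H 0) - 2 * \<bar>H x - H x0\<bar> - 18 * sqrt \<eta> * L) / \<epsilon>) / 2"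
        using eps by (simp add: m_def divide_right_mono)
      also have "\<dots> \<le> (p x)\<^sup>2 + k x * (\<psi> x)\<^sup>2"
        unfolding k_def
        by (rule agmon_energy_lower_bound[where t = "\<lambda>x. V x - E" and Q = "\<lambda>x. Q x - \<mu>" and H = H,
          OF eps \<eta>(1) \<psi> p t A elim(5) Qt bc(1,2) H x0 Vx0' left' xL])
      finally show ?thesis .
    qed
    define J where "J x = integral {0..x} (\<lambda>s. (\<psi> s)\<^sup>2)" for x
    define w where "w x = exp (- f x / \<epsilon>) * (\<psi> x)\<^sup>2" for x
    define J2 where "J2 x = integral {0..x} w" for x
    have sub: "{\<alpha>..\<beta>} \<subseteq> {0..L}" using ab by auto
    have J: "(J has_real_derivative (\<psi> x)\<^sup>2) (at x within {0..L})" if "x \<in> {0..L}" for x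
      unfolding J_def by (rule integral_has_real_derivative[OF _ that]) (intro continuous_intros cont_\<psi>)
    have J2: "(J2 has_real_derivative w x) (at x within {0..L})" if "x \<in> {0..L}" for x
      unfolding J2_def
      by (rule integral_has_real_derivative[OF _ that]) (unfold w_def, intro continuous_intros cont_\<psi> cont_f, use eps in auto)
    have Jm: "m * (l ^ 5 / 30) \<le> B * (J \<beta> - J \<alpha>)"
      unfolding B_def l_def
    proof (rule caccioppoli[where \<psi> = \<psi> and p = p and Q = "\<lambda>x. Q x - \<mu>" and k = k, OF eps])
      show "\<epsilon> \<le> 1" "\<alpha> \<le> \<beta>" using elim(2) ab by auto
      fix x assume x: "x \<in> {\<alpha>..\<beta>}"
      then have xL: "x \<in> {0..L}" using sub by auto
      show "(\<psi> has_real_derivative p x / \<epsilon>) (at x within {\<alpha>..\<beta>})"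
        "(p has_real_derivative (Q x - \<mu>) * \<psi> x / \<epsilon>) (at x within {\<alpha>..\<beta>})"
        "(J has_real_derivative (\<psi> x)\<^sup>2) (at x within {\<alpha>..\<beta>})"
        by (rule DERIV_subset[OF _ sub] \<psi> p J xL)+
      show "\<bar>Q x - \<mu>\<bar> \<le> M"
        using Qt[OF xL] MV[OF xL] \<eta>(2) unfolding M_def by linarith
      show "\<bar>k x\<bar> \<le> M"
        using sqrt_sum_squares_bounds(1,3)[OF \<eta>(1), of "V x - E"] MV[OF xL] \<eta> unfolding k_def M_def by linarith
      show "m \<le> (p x)\<^sup>2 + k x * (\<psi> x)\<^sup>2" by (rule energy[OF x])
    qed
    define c where "c = exp (- (f xs + \<delta> / 8) / \<epsilon>)"
    define I where "I = c * (m * (l ^ 5 / 30) / B)"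
    \<comment> \<open>Only the part of the integral over \<open>{\<alpha>..\<beta>}\<close> is kept;
      there \<open>f\<close> exceeds \<open>f xs\<close> by at most \<open>\<delta> / 8\<close>, so
      the weight is at least \<open>c\<close>.\<close>
    have "c * (J \<beta> - J \<alpha>) \<le> J2 L"
    proof -
      have "J2 \<alpha> - c * J \<alpha> \<le> J2 \<beta> - c * J \<beta>"
      proof (rule has_real_derivative_nonneg_imp_le[where f = "\<lambda>x. J2 x - c * J x"])
        fix x assume x: "x \<in> {\<alpha>..\<beta>}"
        then have xL: "x \<in> {0..L}" using sub by auto
        show "((\<lambda>x. J2 x - c * J x) has_real_derivative w x - c * (\<psi> x)\<^sup>2) (at x within {\<alpha>..\<beta>})"
          by (rule DERIV_diff DERIV_cmult DERIV_subset[OF _ sub] J J2 xL)+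
        have "c \<le> exp (- f x / \<epsilon>)"
        proof -
          have "- (f xs + \<delta> / 8) \<le> - f x" using conjunct1[OF near[OF x]] by linarith
          then show ?thesis unfolding c_def exp_le_cancel_iff using eps by (intro divide_right_mono) auto
        qed
        then show "0 \<le> w x - c * (\<psi> x)\<^sup>2"
          by (simp add: w_def mult_right_mono)
      qed (use ab in simp)
      moreover have "J2 x \<le> J2 y" if "0 \<le> x" "x \<le> y" "y \<le> L" for x y
      proof (rule has_real_derivative_nonneg_imp_le[where f = J2, OF that(2)])
        fix z assume z: "z \<in> {x..y}"
        then have "z \<in> {0..L}" "{x..y} \<subseteq> {0..L}" using that by auto
        then show "(J2 has_real_derivative w z) (at z within {x..y})"
          using DERIV_subset[OF J2] by blast
      qed (simp add: w_def)
      from this[of 0 \<alpha>] this[of \<beta> L] have "J2 0 \<le> J2 \<alpha>" "J2 \<beta> \<le> J2 L" using ab by auto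
      moreover have "J2 0 = 0" by (simp add: J2_def)
      ultimately show ?thesis by (simp add: right_diff_distrib)
    qed
    moreover have "I \<le> c * (J \<beta> - J \<alpha>)"
      unfolding I_def using Jm \<open>0 < B\<close>
      by (intro mult_left_mono) (auto simp: c_def divide_le_eq mult_ac)
    ultimately have I_le: "I \<le> integral {0..L} (\<lambda>x. exp (- f x / \<epsilon>) * (\<psi> x)\<^sup>2)"
      by (simp add: J2_def w_def[abs_def])
    have I_eq: "I = c1 * exp ((2 * gp - 5 / 8 * \<delta>) / \<epsilon>)"
    proof -
      have "(2 * gp - 5 / 8 * \<delta>) / \<epsilon> = - (f xs + \<delta> / 8) / \<epsilon> + (2 * H x0 - 2 * \<bar>H xs - H x0\<bar> - \<delta> / 2) / \<epsilon>"
        unfolding gp_def gap add_divide_distrib[symmetric] by simp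
      then show ?thesis by (simp only: exp_add I_def c_def m_def c1_def) simp
    qed
    have I0: "0 < I" unfolding I_eq using c1 by simp
    have sqrtI: "sqrt I = sqrt c1 * exp ((gp - 5 / 16 * \<delta>) / \<epsilon>)"
    proof -
      have "(2 * gp - 5 / 8 * \<delta>) / \<epsilon> = 2 * ((gp - 5 / 16 * \<delta>) / \<epsilon>)" by simp
      then have "exp ((2 * gp - 5 / 8 * \<delta>) / \<epsilon>) = (exp ((gp - 5 / 16 * \<delta>) / \<epsilon>))\<^sup>2"
        by (simp only: exp_double)
      then show ?thesis by (simp add: I_eq real_sqrt_mult)
    qed
    have "1 \<le> c2 * exp (9 / 16 * \<delta> / \<epsilon>)"
    proof -
      have "1 \<le> c2 * (9 / 16 * \<delta> / \<epsilon>)" using elim(6) eps by (simp add: le_divide_eq)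
      also have "\<dots> \<le> c2 * exp (9 / 16 * \<delta> / \<epsilon>)"
      proof (rule mult_left_mono)
        show "9 / 16 * \<delta> / \<epsilon> \<le> exp (9 / 16 * \<delta> / \<epsilon>)"
          using exp_ge_add_one_self[of "9 / 16 * \<delta> / \<epsilon>"] by linarith
      qed (use c2 in simp)
      finally show ?thesis .
    qed
    then have "exp (1 / \<epsilon> * (gp - E * T - \<delta>)) \<le> c2 * exp (9 / 16 * \<delta> / \<epsilon>) * exp (1 / \<epsilon> * (gp - E * T - \<delta>))"
      by simp
    also have "\<dots> = c2 * (exp (- (E * T + \<delta> / 8) / \<epsilon>) * exp ((gp - 5 / 16 * \<delta>) / \<epsilon>))"
    proof -
      have "9 / 16 * \<delta> / \<epsilon> + 1 / \<epsilon> * (gp - E * T - \<delta>) = - (E * T + \<delta> / 8) / \<epsilon> + (gp - 5 / 16 * \<delta>) / \<epsilon>"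
        using eps by (simp add: field_simps)
      then show ?thesis by (simp only: exp_add[symmetric] mult.assoc)
    qed
    also have "\<dots> \<le> c2 * (exp (- (\<mu> + \<eta>) * T / \<epsilon>) * exp ((gp - 5 / 16 * \<delta>) / \<epsilon>))"
    proof -
      have "(\<mu> + \<eta>) * T \<le> (E + 2 * \<eta>) * T" using \<mu> T by (intro mult_right_mono) auto
      then have "- (E * T + \<delta> / 8) \<le> - (\<mu> + \<eta>) * T" using \<eta>T by (simp add: algebra_simps)
      then have "exp (- (E * T + \<delta> / 8) / \<epsilon>) \<le> exp (- (\<mu> + \<eta>) * T / \<epsilon>)"
        using eps unfolding exp_le_cancel_iff by (intro divide_right_mono) auto
      then show ?thesis using c2 by (intro mult_left_mono mult_right_mono) auto
    qed
    also have "\<dots> = exp (- (\<mu> + \<eta>) * T / \<epsilon>) * sqrt I / sqrt T"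
      by (simp add: sqrtI c2_def)
    finally have "ereal (exp (1 / \<epsilon> * (gp - E * T - \<delta>))) \<le> ereal (exp (- (\<mu> + \<eta>) * T / \<epsilon>) * sqrt I / sqrt T)"
      by simp
    also have "\<dots> \<le> control_cost L a a' b T \<epsilon>"
    proof (rule control_cost_ge_schroedinger[OF L T eps a a' b f f0 \<psi> p[unfolded Q_def] bc _ _ I0 I_le])
      show "- \<mu> \<le> \<eta>" using \<mu> E0 by linarith
      show "0 \<le> \<eta>" using \<eta> by simp
    qed
    finally show ?case .
  qed
qed

theorem theorem1p5:
  fixes L T x0 :: real and a a' b :: "real \<Rightarrow> real"
  assumes "0 < L"
    and "\<forall>x\<in>{0..L}. (a has_real_derivative a' x) (at x within {0..L})"
    and "continuous_on {0..L} a'"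
    and "continuous_on {0..L} b"
    and "x0 \<in> {0<..<L}"
    and "\<forall>x\<in>{0..L}. (potential a has_real_derivative 0) (at x within {0..L}) \<longleftrightarrow> x = x0"
    and "\<forall>x\<in>{0..L}. potential a x0 \<le> potential a x"
    and "0 < T"
  shows "(\<forall>E \<in> potential a ` {0..L}. \<forall>\<delta>>0. \<exists>\<epsilon>0>0. \<forall>\<epsilon>. 0 < \<epsilon> \<and> \<epsilon> < \<epsilon>0 \<longrightarrow>
            control_cost L a a' b T \<epsilon> \<ge> ereal (exp (1 / \<epsilon> * (W_gap L a E - E * T - \<delta>))))
       \<and> T_unif L a a' b \<ge> (SUP E \<in> potential a ` {0..L}. conv_quotient (W_gap L a E) E)"
proof -
  have crit: "x = x0" if x: "x \<in> {0..L}" "a x * a' x / 2 = 0" for x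
  proof -
    have "(potential a has_real_derivative a x * a' x / 2) (at x within {0..L})"
      by (rule potential_deriv[OF assms(2)[rule_format, OF x(1)]])
    then show ?thesis using assms(6) x by simp
  qed
  have x0: "x0 \<in> {0..L}" using assms(5) by simp
  have bound: "\<forall>\<^sub>F \<epsilon> in at_right 0.
      ereal (exp (1 / \<epsilon> * (W_gap L a E - E * S - \<delta>))) \<le> control_cost L a a' b S \<epsilon>"
    if "0 < S" "E \<in> potential a ` {0..L}" "0 < \<delta>" for S E \<delta>
    by (rule control_cost_exponential_lower_bound[OF assms(1) that(1) assms(2)[rule_format] assms(3,4) x0
          crit assms(7)[rule_format] that(2,3)])
  have "conv_quotient (W_gap L a E) E \<le> T_unif L a a' b" if E: "E \<in> potential a ` {0..L}" for E
    unfolding T_unif_def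
  proof (rule Inf_greatest, clarify)
    fix S K :: real
    assume S: "0 < S" and cost: "\<forall>\<epsilon>\<in>{0<..<1}. control_cost L a a' b S \<epsilon> \<le> ereal K"
    \<comment> \<open>With half of a positive excess as margin, the cost would be at least
      \<open>exp (d / \<epsilon>)\<close>, which no \<open>K\<close> bounds as
      \<open>\<epsilon>\<close> tends to \<open>0\<close>.\<close>
    have gap: "W_gap L a E \<le> E * S"
    proof (rule ccontr)
      assume "\<not> W_gap L a E \<le> E * S"
      define d where "d = (W_gap L a E - E * S) / 2"
      have d: "0 < d" using \<open>\<not> _\<close> by (simp add: d_def)
      have "\<forall>\<^sub>F \<epsilon> :: real in at_right 0. 0 < \<epsilon>" by (rule eventually_at_right_less)
      moreover have "\<forall>\<^sub>F \<epsilon> in at_right 0. \<epsilon> * 1 \<le> (1 / 2 :: real)" "\<forall>\<^sub>F \<epsilon> in at_right 0. \<epsilon> * K \<le> d"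
        by (rule eventually_mult_le_at_right_0; use d in simp)+
      moreover note bound[OF S E d]
      ultimately have "\<forall>\<^sub>F \<epsilon> in at_right (0::real). False"
      proof eventually_elim
        case (elim \<epsilon>)
        have "control_cost L a a' b S \<epsilon> \<le> ereal K" using cost elim by auto
        with elim(4) have "ereal (exp (1 / \<epsilon> * (W_gap L a E - E * S - d))) \<le> ereal K"
          by (rule order_trans)
        moreover have "W_gap L a E - E * S - d = d" by (simp add: d_def field_simps)
        ultimately have "exp (d / \<epsilon>) \<le> K" by simp
        moreover have "K \<le> d / \<epsilon>" using elim(1,3) by (simp add: le_divide_eq mult.commute)
        ultimately show False using exp_ge_add_one_self[of "d / \<epsilon>"] by linarith
      qed
      then show False by simp
    qed
    \<comment> \<open>For \<open>E = 0\<close> the inequality \<open>gap\<close> reads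
      \<open>W_gap L a E \<le> 0\<close>, which excludes the infinite branch of
      \<open>conv_quotient\<close>.\<close>
    have "0 \<le> E" using E by (auto simp: potential_def)
    then show "conv_quotient (W_gap L a E) E \<le> ereal S"
      using gap S by (auto simp: conv_quotient_def divide_le_eq mult.commute)
  qed
  moreover have "\<exists>\<epsilon>0>0. \<forall>\<epsilon>. 0 < \<epsilon> \<and> \<epsilon> < \<epsilon>0 \<longrightarrow>
      control_cost L a a' b T \<epsilon> \<ge> ereal (exp (1 / \<epsilon> * (W_gap L a E - E * T - \<delta>)))"
    if "E \<in> potential a ` {0..L}" "0 < \<delta>" for E \<delta>
    using bound[OF assms(8) that] unfolding eventually_at_right_field by blast
  ultimately show ?thesis
    by (auto intro: SUP_least)
qed

end
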